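(* Let $u\le w$ in $\mathbb{P}^*$ and order the maximal chains of $[u,w]$ lexicographically by label sequence. Then: (1) For each normal embedding $\eta_u$ of $u$ into $w$ there is a unique maximal chain of $[u,w]$ with weakly decreasing label sequence ending at $\eta_u$, and the map sending $\eta_u$ to this chain is a bijection from the set of normal embeddings of $u$ into $w$ onto the set of critical chains of $[u,w]$. (2) If $C$ is a critical chain ending at $\eta_u$, then $\mathcal{I}(C)=\mathcal{J}(C)$ and $\#\mathcal{I}(C)=d(\eta_u)+2D(\eta_u)-1$.
   Context: $\mathbb{P}^*$: finite words over the positive integers, $u\le w$ iff $w$ has a subword $w(i_1)\cdots w(i_l)$ ($i_1<\dots<i_l$, $l=|u|$) with $u(j)\le w(i_j)$. Covers: $y$ is obtained from $x$ by decreasing one entry by $1$ (deleting it if it becomes $0$). An expansion of $u$ is a word over nonnegative integers whose restriction to its nonzero positions is $u$; an embedding of $u$ into $w$ is an expansion $\eta_u$ of length $|w|$ with $\eta_u(i)\le w(i)$ for all $i$. A run of $k$'s in $w$ is a maximal index interval $[r,t]$ with $w(r)=\dots=w(t)=k$. An embedding $\eta_u$ is normal if $\eta_u(i)\in\{w(i),w(i)-1,0\}$ for all $i$, and for every run $[r,t]$ of $k$'s in $w$: if $k=1$ then $\eta_u(i)\ne0$ for $r<i\le t$; if $k\ge2$ then $\eta_u(r)\neq 0$. Defect: $d(\eta_u)=\#\{i:\eta_u(i)=w(i)-1\}$; also $D(\eta_u)=\#\{i:\eta_u(i)=0,\ w(i)\ge2\}$. Labels: for a maximal chain $C: w=v_0\gtrdot\cdots\gtrdot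 v_d=u$ set $\eta_{v_0}=w$; for $j\ge1$, $\eta_{v_j}$ is the expansion of $v_j$ obtained from $\eta_{v_{j-1}}$ by subtracting $1$ at a single position $i$, where, if that entry goes from $1$ to $0$, $i$ is the position of the leftmost $1$ of the run of $1$'s of $v_{j-1}$ containing the deleted entry; the label is $l_j=i$, $l(C)=(l_1,\dots,l_d)$, and $C$ ends at $\eta_{v_d}$ (an embedding of $u$ into $w$). $C$ is weakly decreasing if $l_1\ge l_2\ge\cdots\ge l_d$. Chains are ordered lexicographically by label sequence ($C'<C$ means $C'$ first). Intervals: for $0\le i<j\le d$, $j-i\ge 2$, $C(v_i,v_j)=\{v_{i+1},\dots,v_{j-1}\}$; it is skipped if $C\setminus C(v_i,v_j)\subseteq C'$ for some maximal chain $C'<C$; a minimal skipped interval (MSI) is a skipped interval strictly containing no other skipped interval. $\mathcal{I}(C)$ is the set of MSIs, listed $I_1,I_2,\dots$ in order of their first elements along $C$ (from $w$ downward). $\mathcal{J}(C)$ is built inductively: $J_1=I_1$; given $J_1,\dots,J_s$, replace each remaining $I_k$ by $I_k\setminus(J_1\cup\dots\cup J_s)$, discard empty sets and those strictly containing another of these modified sets, and let $J_{s+1}$ be the first remaining one in the order along $C$; stop when none remain. $C$ is critical if $\mathcal{J}(C)$ covers $C$, i.e. $\bigcup\mathcal{J}(C)=\{v_1,\dots,v_{d-1}\}$.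
   Formalization: The formula #I(C)=d(η_u)+2D(η_u)−1 in (2) is stated only for u≠w; for u=w the only chain is (w), it is critical with I(C) empty, and the formula would read 0=−1. *)

theory Defs
  imports Main "HOL-Library.Sublist"
begin

section \<open>Generalised subword order on words over the positive integers\<close>

definition pos_words :: "nat list set" where
  "pos_words = lists {0<..}"

definition gen_subword :: "nat list \<Rightarrow> nat list \<Rightarrow> bool"  (infix "\<preceq>" 50) where
  "u \<preceq> w \<longleftrightarrow> (\<exists>v. subseq v w \<and> list_all2 (\<le>) u v)"

text \<open>Restriction of a word over the nonnegative integers to its nonzero positions.\<close>

definition nonzeros :: "nat list \<Rightarrow> nat list" where
  "nonzeros e = filter (\<lambda>k. k \<noteq> 0) e"

definition covers :: "nat list \<Rightarrow> nat list \<Rightarrow> bool" where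
  "covers x y \<longleftrightarrow> (\<exists>i < length x. y = nonzeros (x[i := x ! i - 1]))"

text \<open>The lemma \<open>covers_iff_order_cover\<close> below shows that, on positive words, this is the
  covering relation of \<open>\<preceq>\<close>.\<close>

lemma gen_subword_iff_list_emb: "u \<preceq> w \<longleftrightarrow> list_emb (\<le>) u w"
proof
  assume "u \<preceq> w"
  then obtain v where v: "subseq v w" "list_all2 (\<le>) u v"
    by (auto simp: gen_subword_def)
  from v show "list_emb (\<le>) u w"
    by (induction arbitrary: u rule: list_emb.induct) (auto simp: list_all2_Cons2)
next
  assume "list_emb (\<le>) u w"
  then show "u \<preceq> w"
  proof (induction rule: list_emb.induct)
    case (list_emb_Nil ys)
    then show ?case by (auto simp: gen_subword_def)
  next
    case (list_emb_Cons xs ys y)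
    then show ?case by (auto simp: gen_subword_def)
  next
    case (list_emb_Cons2 x y xs ys)
    then obtain v where "subseq v ys" "list_all2 (\<le>) xs v"
      by (auto simp: gen_subword_def)
    with list_emb_Cons2 show ?case
      unfolding gen_subword_def by (intro exI[of _ "y # v"]) auto
  qed
qed

lemma nonzeros_pos_words: "w \<in> pos_words \<Longrightarrow> nonzeros w = w"
  by (auto simp: pos_words_def nonzeros_def in_lists_conv_set intro!: filter_True)

lemma nonzeros_in_pos_words: "nonzeros e \<in> pos_words"
  by (auto simp: pos_words_def nonzeros_def)

lemma covers_hd: "ys \<in> pos_words \<Longrightarrow> covers (y # ys) (nonzeros [y - 1] @ ys)"
  unfolding covers_def by (intro exI[of _ 0]) (auto simp: nonzeros_def dest: nonzeros_pos_words)

lemma covers_Cons: "covers ys z \<Longrightarrow> 0 < y \<Longrightarrow> covers (y # ys) (y # z)"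
proof -
  assume "covers ys z" "0 < y"
  then obtain i where "i < length ys" "z = nonzeros (ys[i := ys ! i - 1])"
    by (auto simp: covers_def)
  with \<open>0 < y\<close> show ?thesis
    unfolding covers_def by (intro exI[of _ "Suc i"]) (auto simp: nonzeros_def)
qed

lemma list_emb_sum_list:
  "list_emb (\<le>) u w \<Longrightarrow> sum_list u \<le> sum_list (w :: nat list)"
  by (induction rule: list_emb.induct) auto

lemma list_emb_covers:
  assumes "list_emb (\<le>) y w" "y \<in> pos_words" "w \<in> pos_words" "y \<noteq> w"
  shows "\<exists>z. covers w z \<and> list_emb (\<le>) y z"
  using assms
proof (induction rule: list_emb.induct)
  case (list_emb_Nil ys)
  then obtain a as where "ys = a # as" by (cases ys) auto
  with list_emb_Nil have "as \<in> pos_words" by (auto simp: pos_words_def)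
  from covers_hd[OF this, of a] show ?case
    using \<open>ys = a # as\<close> by auto
next
  case (list_emb_Cons xs ys y)
  then have "ys \<in> pos_words" by (auto simp: pos_words_def)
  from covers_hd[OF this, of y] show ?case
    using list_emb_Cons(1) by (auto intro!: exI list_emb_append2)
next
  case (list_emb_Cons2 x y xs ys)
  then have p: "ys \<in> pos_words" "xs \<in> pos_words" "0 < x" "0 < y"
    by (auto simp: pos_words_def)
  show ?case
  proof (cases "x = y")
    case True
    with list_emb_Cons2 p obtain z where "covers ys z" "list_emb (\<le>) xs z" by auto
    with True p covers_Cons[of ys z y] show ?thesis by (intro exI[of _ "y # z"]) auto
  next
    case False
    with list_emb_Cons2(1) p have "x \<le> y - 1" "y - 1 \<noteq> 0" by auto
    with covers_hd[OF p(1), of y] list_emb_Cons2(2) show ?thesis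
      by (intro exI[of _ "(y - 1) # ys"]) (auto simp: nonzeros_def)
  qed
qed

lemma covers_imp_list_emb:
  assumes "covers w y" "w \<in> pos_words"
  shows "list_emb (\<le>) y w" "sum_list w = Suc (sum_list y)"
proof -
  have nz: "list_emb (\<le>) (nonzeros e) e" "sum_list (nonzeros e) = sum_list e" for e
    by (induction e) (auto simp: nonzeros_def)
  from assms obtain i where i: "i < length w" "y = nonzeros (w[i := w ! i - 1])"
    by (auto simp: covers_def)
  have pos: "0 < w ! i" using assms(2) i(1) by (auto simp: pos_words_def in_lists_conv_set)
  have e: "list_emb (\<le>) (xs[i := xs ! i - 1]) xs" for xs :: "nat list"
  proof (induction xs arbitrary: i)
    case (Cons a xs)
    have r: "list_emb (\<le>) xs xs" by (induction xs) auto
    from Cons r show ?case by (cases i) auto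
  qed auto
  have tr: "list_emb (\<le>) a b \<Longrightarrow> list_emb (\<le>) b c \<Longrightarrow> list_emb (\<le>) a c" for a b c :: "nat list"
    by (rule list_emb_trans) auto
  show "list_emb (\<le>) y w" using tr[OF nz(1) e] i by simp
  have "sum_list (xs[i := xs ! i - 1]) + 1 = sum_list xs"
    if "i < length xs" "0 < xs ! i" for xs :: "nat list"
    using that by (induction xs arbitrary: i) (auto split: nat.splits)
  from this[OF i(1) pos] show "sum_list w = Suc (sum_list y)" using i(2) nz(2) by simp
qed

lemma list_emb_sum_eq:
  assumes "list_emb (\<le>) y w" "y \<in> pos_words" "w \<in> pos_words" "sum_list w \<le> sum_list y"
  shows "y = w"
proof (rule ccontr)
  assume "y \<noteq> w"
  from list_emb_covers[OF assms(1-3) this] obtain z where "covers w z" "list_emb (\<le>) y z"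
    by auto
  with covers_imp_list_emb(2)[OF this(1) assms(3)] list_emb_sum_list[OF this(2)] assms(4)
  show False by simp
qed

lemma covers_iff_order_cover:
  assumes "x \<in> pos_words" "y \<in> pos_words"
  shows "covers x y \<longleftrightarrow>
    y \<preceq> x \<and> y \<noteq> x \<and> \<not> (\<exists>z \<in> pos_words. y \<preceq> z \<and> z \<preceq> x \<and> z \<noteq> y \<and> z \<noteq> x)"
  unfolding gen_subword_iff_list_emb
proof (intro iffI conjI notI)
  assume c: "covers x y"
  show "list_emb (\<le>) y x" using covers_imp_list_emb[OF c assms(1)] by simp
  show "y = x \<Longrightarrow> False" using covers_imp_list_emb[OF c assms(1)] by simp
  assume "\<exists>z \<in> pos_words. list_emb (\<le>) y z \<and> list_emb (\<le>) z x \<and> z \<noteq> y \<and> z \<noteq> x"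
  then obtain z where z: "z \<in> pos_words" "list_emb (\<le>) y z" "list_emb (\<le>) z x" "z \<noteq> y" "z \<noteq> x"
    by auto
  have "sum_list y < sum_list z"
    using list_emb_sum_eq[OF z(2) assms(2) z(1)] z(4) by force
  moreover have "sum_list z < sum_list x"
    using list_emb_sum_eq[OF z(3) z(1) assms(1)] z(5) by force
  ultimately show False using covers_imp_list_emb(2)[OF c assms(1)] by simp
next
  assume a: "list_emb (\<le>) y x \<and> y \<noteq> x \<and>
    \<not> (\<exists>z \<in> pos_words. list_emb (\<le>) y z \<and> list_emb (\<le>) z x \<and> z \<noteq> y \<and> z \<noteq> x)"
  then obtain z where z: "covers x z" "list_emb (\<le>) y z"
    using list_emb_covers assms by blast
  have "z \<in> pos_words" using z(1) nonzeros_in_pos_words by (auto simp: covers_def)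
  moreover have "list_emb (\<le>) z x" "z \<noteq> x" using covers_imp_list_emb[OF z(1) assms(1)] by auto
  ultimately have "z = y" using a z(2) by blast
  with z(1) show "covers x y" by simp
qed


section \<open>Normal embeddings\<close>

text \<open>Positions in words are counted from 0.\<close>

definition is_run :: "nat \<Rightarrow> nat list \<Rightarrow> nat \<Rightarrow> nat \<Rightarrow> bool" where
  "is_run k w r t \<longleftrightarrow>
     r \<le> t \<and> t < length w \<and> (\<forall>i \<in> {r..t}. w ! i = k) \<and>
     (\<forall>r' t'. r' \<le> r \<and> t \<le> t' \<and> t' < length w \<and> (\<forall>i \<in> {r'..t'}. w ! i = k)
        \<longrightarrow> r' = r \<and> t' = t)"

definition is_expansion :: "nat list \<Rightarrow> nat list \<Rightarrow> bool" where
  "is_expansion e u \<longleftrightarrow> nonzeros e = u"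

definition is_embedding :: "nat list \<Rightarrow> nat list \<Rightarrow> nat list \<Rightarrow> bool" where
  "is_embedding e u w \<longleftrightarrow>
     is_expansion e u \<and> length e = length w \<and> (\<forall>i < length w. e ! i \<le> w ! i)"

definition is_normal :: "nat list \<Rightarrow> nat list \<Rightarrow> nat list \<Rightarrow> bool" where
  "is_normal e u w \<longleftrightarrow>
     is_embedding e u w \<and>
     (\<forall>i < length w. e ! i \<in> {w ! i, w ! i - 1, 0}) \<and>
     (\<forall>k r t. is_run k w r t \<longrightarrow>
        (k = 1 \<longrightarrow> (\<forall>i \<in> {r<..t}. e ! i \<noteq> 0)) \<and>
        (k \<ge> 2 \<longrightarrow> e ! r \<noteq> 0))"

definition defect :: "nat list \<Rightarrow> nat list \<Rightarrow> nat" where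
  "defect e w = card {i. i < length w \<and> e ! i = w ! i - 1}"

definition big_defect :: "nat list \<Rightarrow> nat list \<Rightarrow> nat" where
  "big_defect e w = card {i. i < length w \<and> e ! i = 0 \<and> w ! i \<ge> 2}"


section \<open>Maximal chains and their labels\<close>

text \<open>A maximal chain of \<open>[u, w]\<close> is the list \<open>[v\<^sub>0, \<dots>, v\<^sub>d]\<close> of its elements, listed
  downwards from \<open>v\<^sub>0 = w\<close> to \<open>v\<^sub>d = u\<close>.\<close>

definition max_chain :: "nat list \<Rightarrow> nat list \<Rightarrow> nat list list \<Rightarrow> bool" where
  "max_chain u w C \<longleftrightarrow> C \<noteq> [] \<and> hd C = w \<and> last C = u \<and> successively covers C"

definition decr :: "nat list \<Rightarrow> nat \<Rightarrow> nat list" where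
  "decr e i = e[i := e ! i - 1]"

text \<open>Here \<open>e\<close> is the expansion of \<open>v\<^sub>j\<^sub>-\<^sub>1 = nonzeros e\<close> already constructed and \<open>y = v\<^sub>j\<close>.
  The entry at position \<open>i\<close> of \<open>e\<close> is the entry at position \<open>length (nonzeros (take i e))\<close>
  of \<open>v\<^sub>j\<^sub>-\<^sub>1\<close>, so runs are those of \<open>v\<^sub>j\<^sub>-\<^sub>1\<close>: they may straddle zeros of \<open>e\<close>.
  Deleting any 1 from the same run of 1's gives the same word, so it suffices to require that
  the deleted 1 is the leftmost one of its run.  If \<open>nonzeros e\<close> covers \<open>y\<close>, there is exactly
  one such position.\<close>

definition is_label :: "nat list \<Rightarrow> nat list \<Rightarrow> nat \<Rightarrow> bool" where
  "is_label e y i \<longleftrightarrow>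
     i < length e \<and> 0 < e ! i \<and> is_expansion (decr e i) y \<and>
     (e ! i = 1 \<longrightarrow> (\<exists>t. is_run 1 (nonzeros e) (length (nonzeros (take i e))) t))"

definition next_label :: "nat list \<Rightarrow> nat list \<Rightarrow> nat" where
  "next_label e y = (THE i. is_label e y i)"

fun labels_from :: "nat list \<Rightarrow> nat list list \<Rightarrow> nat list" where
  "labels_from e [] = []"
| "labels_from e (y # ys) =
     (let i = next_label e y in i # labels_from (decr e i) ys)"

fun end_from :: "nat list \<Rightarrow> nat list list \<Rightarrow> nat list" where
  "end_from e [] = e"
| "end_from e (y # ys) = end_from (decr e (next_label e y)) ys"

text \<open>As positions are counted from 0, each label is one less than with positions counted
  from 1; this changes neither the lexicographic order nor weak decrease.\<close>

definition chain_labels :: "nat list list \<Rightarrow> nat list" where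
  "chain_labels C = labels_from (hd C) (tl C)"

definition chain_end :: "nat list list \<Rightarrow> nat list" where
  "chain_end C = end_from (hd C) (tl C)"

definition weakly_decreasing :: "nat list list \<Rightarrow> bool" where
  "weakly_decreasing C \<longleftrightarrow> sorted_wrt (\<ge>) (chain_labels C)"

definition chain_less :: "nat list list \<Rightarrow> nat list list \<Rightarrow> bool" where
  "chain_less C' C \<longleftrightarrow> (chain_labels C', chain_labels C) \<in> lexord less_than"


section \<open>Minimal skipped intervals and critical chains\<close>

definition open_interval :: "nat list list \<Rightarrow> nat \<Rightarrow> nat \<Rightarrow> nat list set" where
  "open_interval C i j = {C ! k | k. i < k \<and> k < j}"

definition skipped :: "nat list \<Rightarrow> nat list \<Rightarrow> nat list list \<Rightarrow> nat list set \<Rightarrow> bool" where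
  "skipped u w C S \<longleftrightarrow>
     (\<exists>i j. i + 2 \<le> j \<and> j < length C \<and> S = open_interval C i j) \<and>
     (\<exists>C'. max_chain u w C' \<and> chain_less C' C \<and> set C - S \<subseteq> set C')"

definition MSIs :: "nat list \<Rightarrow> nat list \<Rightarrow> nat list list \<Rightarrow> nat list set set" where
  "MSIs u w C = {S. skipped u w C S \<and> \<not> (\<exists>T. skipped u w C T \<and> T \<subset> S)}"

text \<open>The elements of \<open>MSIs u w C\<close> in order of their first elements along \<open>C\<close>. No two of them
  share their first element, since one would then contain the other.\<close>

definition MSI_list :: "nat list \<Rightarrow> nat list \<Rightarrow> nat list list \<Rightarrow> nat list set list" where
  "MSI_list u w C =
     [open_interval C i j. i \<leftarrow> [0..<length C], j \<leftarrow> [i + 2..<length C],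
        open_interval C i j \<in> MSIs u w C]"

definition prune :: "'a set list \<Rightarrow> 'a set list" where
  "prune Is = filter (\<lambda>S. S \<noteq> {} \<and> \<not> (\<exists>T \<in> set Is. T \<noteq> {} \<and> T \<subset> S)) Is"

text \<open>A set discarded at one stage does not come back at a later stage, so at each stage only
  the latest \<open>J\<^sub>s\<close> has to be removed from the remaining sets.\<close>

function disjointify :: "'a set list \<Rightarrow> 'a set list" where
  "disjointify [] = []"
| "disjointify (I # Is) = I # disjointify (prune (map (\<lambda>S. S - I) Is))"
  by pat_completeness auto
termination
  by (relation "measure length")
     (auto simp: prune_def less_Suc_eq_le intro: order_trans[OF length_filter_le])

definition J_sets :: "nat list \<Rightarrow> nat list \<Rightarrow> nat list list \<Rightarrow> nat list set set" where
  "J_sets u w C = set (disjointify (MSI_list u w C))"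

definition critical :: "nat list \<Rightarrow> nat list \<Rightarrow> nat list list \<Rightarrow> bool" where
  "critical u w C \<longleftrightarrow> \<Union> (J_sets u w C) = open_interval C 0 (length C - 1)"

end

(* A maximal chain is encoded by its label sequence ls; E k is the expansion of v_k. The chain from
   v_i to v_j can be replaced by a lexicographically earlier one iff, for some step a in between,
   v_j still lies below the word obtained from E a by decreasing a positive entry to the left of
   the label of that step ("jump"). A descent of labels thus gives a one-element minimal skipped
   interval (MSI). In any other MSI the labels weakly increase, and comparing the embeddings from
   the right shows that minimality forces them all to equal one position q, whose entry drops from
   x >= 2 to 0 while the preceding nonzero letter is also x. Hence no MSI contains an ascent, and
   if the MSIs cover the chain then the labels decrease weakly and the chain ends at a normal
   embedding. Conversely, for a decreasing chain with a normal end the MSIs are the descents and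
   one block for each position counted by D; they are disjoint, so I(C) = J(C), and counting
   descents by distinct labels gives (d + D - 1) + D. *)

theory Submission
  imports Defs "HOL-Library.Multiset"
begin

text \<open>One word can have several expansions, and a competing chain may reach \<open>v_j\<close>
  through another expansion than \<open>C\<close> does. Skipping is therefore tested on words, by an
  embedding; what happens after the jump cannot affect the lexicographic order, which is decided
  there. Blocks of equal labels are skipped because of the same ambiguity: next to each other, two
  equal letters x are interchangeable, so removing the right one leads to the same word as removing
  the left one, and the latter has smaller labels. This explains the opposite rules in the
  definition of normality. A letter of size at least 2 may vanish only if an equal letter stands on
  its left, since otherwise its block is not skipped; for a 1 there is no block, and the labelling
  rule itself places the deletion at the start of the run.\<close>

section \<open>The subword order read from the right, and words versus expansions\<close>

abbreviation emb :: "nat list \<Rightarrow> nat list \<Rightarrow> bool" where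
  "emb \<equiv> list_emb (\<le>)"

lemma emb_refl [simp]: "emb u u"
  by (rule list_emb_refl) simp

lemma emb_trans: "emb u v \<Longrightarrow> emb v w \<Longrightarrow> emb u w"
  by (rule list_emb_trans) auto

text \<open>The letter \<open>y\<close> is either unmatched or matched with \<open>x\<close>, the
  only letter that can use the last place. This gives a recursion for comparing words from the
  right.\<close>

lemma emb_snoc_iff: "emb (u @ [x]) (v @ [y]) \<longleftrightarrow> emb (u @ [x]) v \<or> (emb u v \<and> x \<le> y)"
proof
  assume "emb (u @ [x]) (v @ [y])"
  then obtain us vs where *: "v @ [y] = us @ vs" "emb u us" "emb [x] vs"
    using list_emb_appendD by blast
  then have "vs \<noteq> []" by auto
  then obtain vs' where vs: "vs = vs' @ [y]" "v = us @ vs'"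
    using * by (metis append_assoc append_butlast_last_id last_appendR last_snoc butlast_append butlast_snoc)
  show "emb (u @ [x]) v \<or> (emb u v \<and> x \<le> y)"
  proof (cases "\<exists>c\<in>set vs'. x \<le> c")
    case True
    then have "emb [x] vs'" by (auto simp: in_set_conv_decomp intro!: list_emb_append2)
    then show ?thesis using *(2) vs by (auto intro: list_emb_append_mono)
  next
    case False
    have "\<exists>c\<in>set vs. x \<le> c" using *(3) list_emb_set by fastforce
    then have "x \<le> y" using False vs by auto
    then show ?thesis using *(2) vs by (auto intro: list_emb_prefix)
  qed
next
  assume "emb (u @ [x]) v \<or> (emb u v \<and> x \<le> y)"
  then show "emb (u @ [x]) (v @ [y])"
    by (auto intro: list_emb_append_mono list_emb_prefix)
qed

text \<open>Matching equal last letters with each other loses nothing: if the final letter on the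
  left is placed earlier, dropping it still leaves an embedding of the rest.\<close>

lemma emb_append_cancel: "emb (u @ t) (v @ t) \<longleftrightarrow> emb u v"
proof (induction t rule: rev_induct)
  case (snoc x t)
  have "emb (u @ t) (v @ t)" if "emb ((u @ t) @ [x]) (v @ t)"
    using that by (metis emb_refl emb_trans list_emb_prefix)
  then have "emb (u @ t @ [x]) (v @ t @ [x]) \<longleftrightarrow> emb (u @ t) (v @ t)"
    using emb_snoc_iff[of "u @ t" x "v @ t" x] by auto
  then show ?case using snoc by simp
qed simp

lemma nonzeros_append [simp]: "nonzeros (u @ v) = nonzeros u @ nonzeros v"
  by (simp add: nonzeros_def)

lemma nonzeros_Nil [simp]: "nonzeros [] = []"
  by (simp add: nonzeros_def)

lemma nonzeros_Cons: "nonzeros (x # v) = (if x = 0 then nonzeros v else x # nonzeros v)"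
  by (simp add: nonzeros_def)

lemma sum_list_nonzeros [simp]: "sum_list (nonzeros e) = sum_list e"
  by (induction e) (auto simp: nonzeros_Cons)

lemma length_decr [simp]: "length (decr e i) = length e"
  by (simp add: decr_def)

lemma length_foldl_decr [simp]: "length (foldl decr e xs) = length e"
  by (induction xs arbitrary: e) auto

lemma nth_decr: "i < length e \<Longrightarrow> decr e i ! p = (if p = i then e ! p - 1 else e ! p)"
  by (simp add: decr_def)

lemma decr_split: "i = length A \<Longrightarrow> decr (A @ x # B) i = A @ (x - 1) # B"
  by (simp add: decr_def)

lemma sum_list_decr:
  assumes "i < length e" "0 < e ! i"
  shows "sum_list e = Suc (sum_list (decr e i))"
proof -
  define A x B where "A = take i e" and "x = e ! i" and "B = drop (Suc i) e"
  have "e = A @ x # B" "i = length A"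
    using assms by (simp_all add: A_def x_def B_def id_take_nth_drop)
  moreover have "0 < x" using assms by (simp add: x_def)
  ultimately show ?thesis by (simp add: decr_split)
qed

lemma nonzeros_split:
  assumes "nonzeros e = A @ x # B"
  obtains A' B' where "e = A' @ x # B'" "nonzeros A' = A" "nonzeros B' = B"
proof -
  have "\<exists>A' B'. e = A' @ x # B' \<and> nonzeros A' = A \<and> nonzeros B' = B"
    using assms
  proof (induction e arbitrary: A)
    case (Cons a e)
    show ?case
    proof (cases "a \<noteq> 0 \<and> A = []")
      case True
      with Cons.prems show ?thesis
        by (intro exI[of _ "[]"] exI[of _ e]) (simp add: nonzeros_Cons)
    next
      case False
      define A0 where "A0 = (if a = 0 then A else tl A)"
      have A: "A = (if a = 0 then A0 else a # A0)" "nonzeros e = A0 @ x # B"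
        using Cons.prems False unfolding A0_def
        by (cases A; simp add: nonzeros_Cons split: if_splits)+
      from Cons.IH[OF A(2)] obtain A' B'
        where "e = A' @ x # B'" "nonzeros A' = A0" "nonzeros B' = B" by blast
      then show ?thesis
        using A(1) by (intro exI[of _ "a # A'"] exI[of _ B']) (simp add: nonzeros_Cons)
    qed
  qed simp
  then show ?thesis using that by blast
qed

lemma nonzeros_idem [simp]: "nonzeros (nonzeros v) = nonzeros v"
  by (simp add: nonzeros_def)

text \<open>\<open>covers\<close> uses positions of the word, labels use positions of an expansion.
  After this translation a chain is a sequence of decreases in a list of fixed length.\<close>

lemma covers_nonzeros_iff:
  "covers (nonzeros e) y \<longleftrightarrow> (\<exists>i < length e. 0 < e ! i \<and> y = nonzeros (decr e i))"
proof
  assume "covers (nonzeros e) y"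
  then obtain k where k: "k < length (nonzeros e)"
    and y: "y = nonzeros ((nonzeros e)[k := nonzeros e ! k - 1])"
    by (auto simp: covers_def)
  define A x B where "A = take k (nonzeros e)" and "x = nonzeros e ! k"
    and "B = drop (Suc k) (nonzeros e)"
  have nz: "nonzeros e = A @ x # B" using k by (simp add: A_def x_def B_def id_take_nth_drop)
  have lenA: "length A = k" using k by (simp add: A_def)
  from nz obtain A' B' where e: "e = A' @ x # B'" "nonzeros A' = A" "nonzeros B' = B"
    by (rule nonzeros_split)
  have "x \<in> set (nonzeros e)" using nz by simp
  then have "0 < x" by (simp add: nonzeros_def)
  moreover have "(nonzeros e)[k := nonzeros e ! k - 1] = A @ (x - 1) # B"
    using lenA by (simp add: nz list_update_append nth_append)
  then have "y = nonzeros (decr e (length A'))"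
    using e nonzeros_idem[of A'] nonzeros_idem[of B'] y by (simp add: decr_split nonzeros_Cons)
  ultimately show "\<exists>i < length e. 0 < e ! i \<and> y = nonzeros (decr e i)"
    using e(1) by (intro exI[of _ "length A'"]) (auto simp: nth_append)
next
  assume "\<exists>i < length e. 0 < e ! i \<and> y = nonzeros (decr e i)"
  then obtain i where i: "i < length e" "0 < e ! i" "y = nonzeros (decr e i)" by blast
  define A B where "A = take i e" and "B = drop (Suc i) e"
  have e: "e = A @ e ! i # B" "length A = i" using i by (simp_all add: A_def B_def id_take_nth_drop)
  have dec: "decr e i = A @ (e ! i - 1) # B" using e decr_split by metis
  have nz: "nonzeros e = nonzeros A @ e ! i # nonzeros B"
    using i(2) by (subst e(1)) (simp add: nonzeros_Cons)
  show "covers (nonzeros e) y"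
    unfolding covers_def
  proof (intro exI conjI)
    show "length (nonzeros A) < length (nonzeros e)" by (simp add: nz)
    show "y = nonzeros ((nonzeros e)[length (nonzeros A) := nonzeros e ! length (nonzeros A) - 1])"
      by (simp add: nz i(3) dec list_update_append nth_append nonzeros_Cons)
  qed
qed

section \<open>Labels and runs\<close>

lemma is_run_start:
  assumes "is_run k w r t" "0 < r"
  shows "w ! (r - 1) \<noteq> k"
proof
  assume "w ! (r - 1) = k"
  moreover have "{r - 1..t} = insert (r - 1) {r..t}" using assms by (auto simp: is_run_def)
  ultimately have "r - 1 = r"
    using assms unfolding is_run_def by (metis diff_le_self dual_order.refl insert_iff)
  then show False using assms by simp
qed

lemma is_run_extend:
  assumes "r \<le> q" "q < length w" "\<And>i. i \<in> {r..q} \<Longrightarrow> w ! i = k" "r = 0 \<or> w ! (r - 1) \<noteq> k"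
  obtains t where "is_run k w r t" "q \<le> t"
proof -
  let ?T = "{t. q \<le> t \<and> t < length w \<and> (\<forall>i\<in>{r..t}. w ! i = k)}"
  define t where "t = Max ?T"
  have fin: "finite ?T" by simp
  have "q \<in> ?T" using assms by simp
  then have tT: "t \<in> ?T" unfolding t_def using Max_in[OF fin] by blast
  have "is_run k w r t"
    unfolding is_run_def
  proof (intro conjI allI impI)
    fix r' t' assume a: "r' \<le> r \<and> t \<le> t' \<and> t' < length w \<and> (\<forall>i\<in>{r'..t'}. w ! i = k)"
    then have "t' \<in> ?T" using tT by auto
    then have "t' \<le> t" unfolding t_def using Max_ge[OF fin] by blast
    then show "t' = t" using a by simp
    show "r' = r"
    proof (rule ccontr)
      assume "r' \<noteq> r"
      then have "r' \<le> r - 1" "0 < r" using a by auto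
      then have "w ! (r - 1) = k" using a tT assms(1) by auto
      then show False using assms(4) \<open>0 < r\<close> by simp
    qed
  qed (use tT assms(1) in auto)
  then show ?thesis using that tT by blast
qed

lemma is_run_leftmost_iff:
  assumes "r < length v" "v ! r = 1"
  shows "(\<exists>t. is_run 1 v r t) \<longleftrightarrow> take r v = [] \<or> last (take r v) \<noteq> 1"
proof -
  have "(\<exists>t. is_run 1 v r t) \<longleftrightarrow> r = 0 \<or> v ! (r - 1) \<noteq> 1"
    using is_run_start[of 1 v r] is_run_extend[of r r v 1] assms by auto
  then show ?thesis using assms(1) by (cases r) (auto simp: take_Suc_conv_app_nth)
qed

text \<open>This is \<open>is_label\<close> freed of the target word. Being leftmost in a run of 1's
  is read off the last nonzero entry before \<open>i\<close>, so zeros of \<open>e\<close> in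
  between do not matter.\<close>

definition admissible :: "nat list \<Rightarrow> nat \<Rightarrow> bool" where
  "admissible e i \<longleftrightarrow> i < length e \<and> 0 < e ! i \<and>
     (e ! i = 1 \<longrightarrow> nonzeros (take i e) = [] \<or> last (nonzeros (take i e)) \<noteq> 1)"

lemma is_label_iff: "is_label e y i \<longleftrightarrow> admissible e i \<and> y = nonzeros (decr e i)"
proof (cases "i < length e \<and> 0 < e ! i")
  case True
  define A B where "A = take i e" and "B = drop (Suc i) e"
  have e: "e = A @ e ! i # B" using True by (simp add: A_def B_def id_take_nth_drop)
  have nz: "nonzeros e = nonzeros A @ e ! i # nonzeros B"
    using True by (subst e) (simp add: nonzeros_Cons)
  then show ?thesis
    using is_run_leftmost_iff[of "length (nonzeros A)" "nonzeros e"] True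
    by (auto simp: is_label_def admissible_def is_expansion_def A_def)
qed (auto simp: is_label_def admissible_def)

text \<open>Cancelling the parts outside of \<open>i\<close> and \<open>j\<close> leaves an equation
  around \<open>B\<close>. Its first letters force \<open>e ! i = 1\<close>, its length forces
  \<open>e ! j = 1\<close>, and then the last nonzero letter before \<open>j\<close> is a 1, so
  \<open>j\<close> is not leftmost in its run.\<close>

lemma admissible_inj_aux:
  assumes "admissible e i" "admissible e j" "nonzeros (decr e i) = nonzeros (decr e j)" "i < j"
  shows False
proof -
  define A B D where "A = take i e" and "B = take (j - Suc i) (drop (Suc i) e)"
    and "D = drop (Suc j) e"
  have ij: "j < length e" "0 < e ! i" "0 < e ! j"
    using assms by (auto simp: admissible_def)
  have tj: "take j e = A @ e ! i # B" "length A = i"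
  proof -
    have "j = i + Suc (j - Suc i)" using assms(4) by simp
    then have "take j e = take i e @ take (Suc (j - Suc i)) (drop i e)" by (metis take_add)
    also have "drop i e = e ! i # drop (Suc i) e"
      using assms(4) ij by (simp add: Cons_nth_drop_Suc)
    finally show "take j e = A @ e ! i # B" by (simp add: A_def B_def)
    show "length A = i" using assms(4) ij by (simp add: A_def)
  qed
  then have e: "e = A @ e ! i # B @ e ! j # D"
    using ij id_take_nth_drop[of j e] by (simp add: D_def)
  have lj: "j = length (A @ e ! i # B)" using tj ij by (metis length_take min.absorb4)
  have di: "decr e i = A @ (e ! i - 1) # B @ e ! j # D"
    using decr_split[of i A "e ! i" "B @ e ! j # D"] tj(2) e by metis
  have dj: "decr e j = (A @ e ! i # B) @ (e ! j - 1) # D"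
    using decr_split[of j "A @ e ! i # B" "e ! j" D] lj e by simp
  have eq: "nonzeros [e ! i - 1] @ nonzeros B @ [e ! j] = [e ! i] @ nonzeros B @ nonzeros [e ! j - 1]"
    using assms(3) ij unfolding di dj by (auto simp: nonzeros_Cons split: if_splits)
  have i1: "e ! i = 1"
    using eq ij by (auto simp: nonzeros_Cons split: if_splits)
  have j1: "e ! j = 1"
  proof (rule ccontr)
    assume "e ! j \<noteq> 1"
    then have "length (nonzeros [e ! j - 1]) = 1" using ij by (simp add: nonzeros_Cons)
    with arg_cong[OF eq, of length] i1 show False by (simp add: nonzeros_Cons)
  qed
  have "nonzeros B @ [1] = 1 # nonzeros B" using eq i1 j1 by (simp add: nonzeros_Cons)
  then have "last (1 # nonzeros B) = 1" by (metis last_snoc)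
  moreover have "nonzeros (take j e) = nonzeros A @ 1 # nonzeros B"
    using tj i1 by (simp add: nonzeros_Cons)
  ultimately show False using assms(2) j1 by (auto simp: admissible_def)
qed

lemma admissible_inj:
  "admissible e i \<Longrightarrow> admissible e j \<Longrightarrow> nonzeros (decr e i) = nonzeros (decr e j) \<Longrightarrow> i = j"
  using admissible_inj_aux[of e i j] admissible_inj_aux[of e j i] by (metis linorder_neqE_nat)

text \<open>A 1 that is not leftmost in its run is preceded by another 1 with only zeros in between;
  deleting that one gives the same word, and the search continues to the left. The bound
  \<open>j \<le> i\<close> keeps the label of a jump below the label it competes with.\<close>

lemma admissible_exists:
  assumes "i < length e" "0 < e ! i"
  obtains j where "j \<le> i" "admissible e j" "nonzeros (decr e j) = nonzeros (decr e i)"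
proof -
  have "\<exists>j \<le> i. admissible e j \<and> nonzeros (decr e j) = nonzeros (decr e i)"
    using assms
  proof (induction i rule: less_induct)
    case (less i)
    show ?case
    proof (cases "admissible e i")
      case False
      then have i: "e ! i = 1" "nonzeros (take i e) \<noteq> []" "last (nonzeros (take i e)) = 1"
        using less.prems by (auto simp: admissible_def)
      then have "nonzeros (take i e) = butlast (nonzeros (take i e)) @ 1 # []"
        by (metis append_butlast_last_id)
      then obtain A B where AB: "take i e = A @ 1 # B" "nonzeros B = []"
        by (rule nonzeros_split)
      define D where "D = drop (Suc i) e"
      have e: "e = A @ 1 # B @ 1 # D"
        using id_take_nth_drop[of i e] AB i less.prems by (simp add: D_def)
      have li: "i = length (A @ 1 # B)" using AB less.prems by (metis length_take min.absorb4)
      have "nonzeros (decr e (length A)) = nonzeros (decr e i)"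
        unfolding e using decr_split[of i "A @ 1 # B" 1 D] li AB(2)
        by (simp add: decr_split nonzeros_Cons)
      moreover have "length A < i" "length A < length e" "e ! length A = 1"
        unfolding li by (simp_all add: e nth_append)
      ultimately show ?thesis using less.IH[of "length A"] by (metis le_trans less_imp_le zero_less_one)
    qed auto
  qed
  then show ?thesis using that by blast
qed

lemma next_label_eqI: "admissible e i \<Longrightarrow> next_label e (nonzeros (decr e i)) = i"
  unfolding next_label_def is_label_iff by (rule the_equality) (auto dest: admissible_inj)

lemma covers_next_label:
  assumes "covers (nonzeros e) y"
  shows "admissible e (next_label e y)" "nonzeros (decr e (next_label e y)) = y"
proof -
  obtain i where "i < length e" "0 < e ! i" "y = nonzeros (decr e i)"
    using assms by (auto simp: covers_nonzeros_iff)
  then obtain j where "admissible e j" "nonzeros (decr e j) = y"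
    using admissible_exists by metis
  then show "admissible e (next_label e y)" "nonzeros (decr e (next_label e y)) = y"
    using next_label_eqI by auto
qed

section \<open>Chains and their label sequences\<close>

fun admissible_seq :: "nat list \<Rightarrow> nat list \<Rightarrow> bool" where
  "admissible_seq e [] = True"
| "admissible_seq e (i # ls) = (admissible e i \<and> admissible_seq (decr e i) ls)"

fun chain_of :: "nat list \<Rightarrow> nat list \<Rightarrow> nat list list" where
  "chain_of e [] = [nonzeros e]"
| "chain_of e (i # ls) = nonzeros e # chain_of (decr e i) ls"

lemma chain_of_Cons_ex: "\<exists>ys. chain_of e ls = nonzeros e # ys"
  by (cases ls) auto

lemma hd_chain_of [simp]: "hd (chain_of e ls) = nonzeros e"
  by (cases ls) auto

lemma chain_of_neq_Nil [simp]: "chain_of e ls \<noteq> []"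
  by (cases ls) auto

lemma length_chain_of [simp]: "length (chain_of e ls) = Suc (length ls)"
  by (induction ls arbitrary: e) auto

lemma nth_chain_of:
  "k \<le> length ls \<Longrightarrow> chain_of e ls ! k = nonzeros (foldl decr e (take k ls))"
  by (induction ls arbitrary: e k) (auto simp: nth_Cons split: nat.splits)

lemma last_chain_of: "last (chain_of e ls) = nonzeros (foldl decr e ls)"
  by (simp add: last_conv_nth nth_chain_of)

lemma labels_from_chain_of:
  "admissible_seq e ls \<Longrightarrow> labels_from e (tl (chain_of e ls)) = ls"
proof (induction ls arbitrary: e)
  case (Cons i ls)
  obtain ys where ys: "chain_of (decr e i) ls = nonzeros (decr e i) # ys"
    using chain_of_Cons_ex by blast
  have "labels_from (decr e i) ys = ls" using Cons.IH[of "decr e i"] Cons.prems ys by simp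
  with Cons.prems ys show ?case by (simp add: next_label_eqI Let_def)
qed simp

lemma end_from_eq: "end_from e ys = foldl decr e (labels_from e ys)"
  by (induction ys arbitrary: e) (auto simp: Let_def)

lemma successively_chain_of: "admissible_seq e ls \<Longrightarrow> successively covers (chain_of e ls)"
proof (induction ls arbitrary: e)
  case (Cons i ls)
  then have "covers (nonzeros e) (nonzeros (decr e i))"
    by (auto simp: covers_nonzeros_iff admissible_def)
  with Cons show ?case by (simp add: successively_Cons)
qed simp

lemma chain_of_labels_from:
  "successively covers (nonzeros e # ys) \<Longrightarrow>
     admissible_seq e (labels_from e ys) \<and> chain_of e (labels_from e ys) = nonzeros e # ys"
proof (induction ys arbitrary: e)
  case (Cons y ys)
  then have "covers (nonzeros e) y" by simp
  note n = covers_next_label[OF this]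
  from Cons.prems have "successively covers (nonzeros (decr e (next_label e y)) # ys)"
    unfolding n(2) by simp
  from Cons.IH[OF this] n show ?case by (simp add: Let_def)
qed simp

lemma max_chain_conv:
  assumes "w \<in> pos_words"
  shows "max_chain u w C \<longleftrightarrow>
    (\<exists>ls. admissible_seq w ls \<and> C = chain_of w ls \<and> u = nonzeros (foldl decr w ls))"
proof -
  have w: "nonzeros w = w" using assms by (rule nonzeros_pos_words)
  show ?thesis
  proof
    assume C: "max_chain u w C"
    then have "C = nonzeros w # tl C" unfolding max_chain_def w by (metis list.collapse)
    then have "admissible_seq w (labels_from w (tl C)) \<and> chain_of w (labels_from w (tl C)) = C"
      using chain_of_labels_from[of w "tl C"] C by (metis max_chain_def)
    then show "\<exists>ls. admissible_seq w ls \<and> C = chain_of w ls \<and> u = nonzeros (foldl decr w ls)"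
      using C last_chain_of by (metis max_chain_def)
  next
    assume "\<exists>ls. admissible_seq w ls \<and> C = chain_of w ls \<and> u = nonzeros (foldl decr w ls)"
    then show "max_chain u w C"
      by (auto simp: max_chain_def w last_chain_of successively_chain_of)
  qed
qed

lemma chain_labels_chain_of:
  "w \<in> pos_words \<Longrightarrow> admissible_seq w ls \<Longrightarrow> chain_labels (chain_of w ls) = ls"
  by (simp add: chain_labels_def labels_from_chain_of nonzeros_pos_words)

lemma chain_end_chain_of:
  "w \<in> pos_words \<Longrightarrow> admissible_seq w ls \<Longrightarrow> chain_end (chain_of w ls) = foldl decr w ls"
  by (simp add: chain_end_def end_from_eq labels_from_chain_of nonzeros_pos_words)

lemma admissible_seq_append:
  "admissible_seq e (xs @ ys) \<longleftrightarrow> admissible_seq e xs \<and> admissible_seq (foldl decr e xs) ys"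
  by (induction xs arbitrary: e) auto

lemma admissible_seq_nth:
  "admissible_seq e ls \<Longrightarrow> k < length ls \<Longrightarrow> admissible (foldl decr e (take k ls)) (ls ! k)"
  by (induction ls arbitrary: e k) (auto simp: nth_Cons split: nat.splits)

text \<open>As long as the word differs from \<open>y\<close>, some cover of it is still above
  \<open>y\<close>, and the sum of the entries drops. This supplies the middle piece when a chain is
  rerouted.\<close>

lemma emb_admissible_seq:
  assumes "emb y (nonzeros e)" "y \<in> pos_words"
  obtains ls where "admissible_seq e ls" "nonzeros (foldl decr e ls) = y"
proof -
  have "\<exists>ls. admissible_seq e ls \<and> nonzeros (foldl decr e ls) = y"
    using assms
  proof (induction "sum_list e" arbitrary: e rule: less_induct)
    case less
    show ?case
    proof (cases "y = nonzeros e")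
      case True
      then show ?thesis by (intro exI[of _ "[]"]) simp
    next
      case False
      then obtain z where z: "covers (nonzeros e) z" "emb y z"
        using list_emb_covers[OF less.prems nonzeros_in_pos_words] by blast
      define i where "i = next_label e z"
      have i: "admissible e i" "nonzeros (decr e i) = z"
        unfolding i_def by (fact covers_next_label[OF z(1)])+
      then have "sum_list (decr e i) < sum_list e"
        using sum_list_decr[of i e] by (simp add: admissible_def)
      from less.hyps[OF this] z i less.prems obtain ls
        where "admissible_seq (decr e i) ls \<and> nonzeros (foldl decr (decr e i) ls) = y" by auto
      then show ?thesis using i by (intro exI[of _ "i # ls"]) simp
    qed
  qed
  then show ?thesis using that by blast
qed

section \<open>Skipped intervals\<close>

lemma emb_decr:
  assumes "i < length e" "0 < e ! i"
  shows "emb (nonzeros (decr e i)) (nonzeros e)"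
proof -
  have "covers (nonzeros e) (nonzeros (decr e i))"
    using assms by (auto simp: covers_nonzeros_iff)
  then show ?thesis using covers_imp_list_emb(1) nonzeros_in_pos_words by blast
qed

lemma emb_sum_eqD: "emb (nonzeros e) (nonzeros f) \<Longrightarrow> sum_list e = sum_list f \<Longrightarrow> nonzeros e = nonzeros f"
  using list_emb_sum_eq[of "nonzeros e" "nonzeros f"] by (simp add: nonzeros_in_pos_words)

lemma chain_of_append:
  "chain_of e (xs @ ys) = butlast (chain_of e xs) @ chain_of (foldl decr e xs) ys"
  by (induction xs arbitrary: e) auto

section \<open>A single chain and a criterion for its skipped intervals\<close>

locale labelled_chain =
  fixes w ls :: "nat list"
  assumes pos: "w \<in> pos_words" and adm: "admissible_seq w ls"
begin

definition E :: "nat \<Rightarrow> nat list" where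
  "E k = foldl decr w (take k ls)"

abbreviation C :: "nat list list" where
  "C \<equiv> chain_of w ls"

abbreviation d :: nat where
  "d \<equiv> length ls"

abbreviation bot_word :: "nat list" where
  "bot_word \<equiv> nonzeros (E d)"

lemma E_0 [simp]: "E 0 = w"
  by (simp add: E_def)

lemma E_Suc: "k < d \<Longrightarrow> E (Suc k) = decr (E k) (ls ! k)"
  by (simp add: E_def take_Suc_conv_app_nth)

lemma length_E [simp]: "length (E k) = length w"
  by (simp add: E_def)

lemma admissible_E: "k < d \<Longrightarrow> admissible (E k) (ls ! k)"
  unfolding E_def by (rule admissible_seq_nth[OF adm])

lemma label_less: "k < d \<Longrightarrow> ls ! k < length w" and E_label_pos: "k < d \<Longrightarrow> 0 < E k ! (ls ! k)"
  using admissible_E by (auto simp: admissible_def)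

lemma C_nth: "k \<le> d \<Longrightarrow> C ! k = nonzeros (E k)"
  by (simp add: nth_chain_of E_def)

text \<open>The sum of the entries is a rank function: an element determines its index in every
  chain starting at \<open>w\<close>, so sets of words on a chain can be treated as sets of
  indices.\<close>

lemma sum_E: "k \<le> d \<Longrightarrow> sum_list (E k) + k = sum_list w"
proof (induction k)
  case (Suc k)
  then show ?case
    using sum_list_decr[of "ls ! k" "E k"] label_less[of k] E_label_pos[of k] by (simp add: E_Suc)
qed simp

lemma sum_C: "k \<le> d \<Longrightarrow> sum_list (C ! k) + k = sum_list w"
  using sum_E by (simp add: C_nth)

lemma C_inj: "k \<le> d \<Longrightarrow> m \<le> d \<Longrightarrow> C ! k = C ! m \<Longrightarrow> k = m"
  using sum_C by (metis add_left_imp_eq)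

lemma emb_E: "k \<le> m \<Longrightarrow> m \<le> d \<Longrightarrow> emb (nonzeros (E m)) (nonzeros (E k))"
proof (induction m rule: dec_induct)
  case (step n)
  then show ?case
    using emb_decr[of "ls ! n" "E n"] label_less[of n] E_label_pos[of n]
    by (auto simp: E_Suc intro: emb_trans)
qed simp

lemma E_nth_Suc: "k < d \<Longrightarrow> E (Suc k) ! p = (if p = ls ! k then E k ! p - 1 else E k ! p)"
  using label_less[of k] by (simp add: E_Suc nth_decr)

lemma E_nth_unchanged:
  "k \<le> m \<Longrightarrow> m \<le> d \<Longrightarrow> (\<And>n. k \<le> n \<Longrightarrow> n < m \<Longrightarrow> ls ! n \<noteq> p) \<Longrightarrow> E m ! p = E k ! p"
proof (induction m rule: dec_induct)
  case (step n)
  then show ?case using E_nth_Suc[of n p] by (metis Suc_leD Suc_le_lessD lessI less_SucI)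
qed simp

lemma E_nth_antimono: "k \<le> m \<Longrightarrow> m \<le> d \<Longrightarrow> E m ! p \<le> E k ! p"
proof (induction m rule: dec_induct)
  case (step n)
  then show ?case using E_nth_Suc[of n p] by (auto split: if_splits)
qed simp

lemma E_nth_const_label:
  "k \<le> m \<Longrightarrow> m \<le> d \<Longrightarrow> (\<And>n. k \<le> n \<Longrightarrow> n < m \<Longrightarrow> ls ! n = p) \<Longrightarrow> E m ! p + (m - k) = E k ! p"
proof (induction m rule: dec_induct)
  case (step n)
  then have "E n ! p + (n - k) = E k ! p" "ls ! n = p" by auto
  then show ?case using E_nth_Suc[of n p] E_label_pos[of n] step by auto
qed simp

lemma set_C: "set C = (\<lambda>k. C ! k) ` {..d}"
  by (auto simp: set_conv_nth less_Suc_eq_le)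

text \<open>The rest of the competing chain is not recorded: \<open>emb_admissible_seq\<close>
  recovers it from the embedding.\<close>

definition jump :: "nat \<Rightarrow> nat \<Rightarrow> nat \<Rightarrow> bool" where
  "jump a b j \<longleftrightarrow> a < j \<and> j \<le> d \<and> b < ls ! a \<and> 0 < E a ! b \<and>
     emb (nonzeros (E j)) (nonzeros (decr (E a) b))"

text \<open>For \<open>j = a + 1\<close> both words would have the same rank and hence coincide. The
  only admissible position leading to this word is \<open>ls ! a\<close>, yet there would be one at
  or to the left of \<open>b\<close>.\<close>

lemma jump_less: 
  assumes "jump a b j"
  shows "a + 2 \<le> j"
proof (rule ccontr)
  assume "\<not> a + 2 \<le> j"
  then have j: "j = Suc a" "a < d" using assms by (auto simp: jump_def)
  have b: "b < ls ! a" "0 < E a ! b" "b < length (E a)"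
    using assms label_less[OF j(2)] by (auto simp: jump_def)
  obtain b' where b': "b' \<le> b" "admissible (E a) b'" "nonzeros (decr (E a) b') = nonzeros (decr (E a) b)"
    using admissible_exists[OF b(3,2)] by blast
  have "sum_list (E j) = sum_list (decr (E a) b)"
    using sum_list_decr[OF b(3,2)] sum_E[of a] sum_E[of "Suc a"] j by simp
  then have "nonzeros (E j) = nonzeros (decr (E a) b)"
    using assms emb_sum_eqD by (auto simp: jump_def)
  then have "b' = ls ! a"
    using admissible_inj[OF b'(2) admissible_E[OF j(2)]] b'(3) j by (simp add: E_Suc)
  then show False using b b' by simp
qed

definition skips :: "nat \<Rightarrow> nat \<Rightarrow> bool" where
  "skips i j \<longleftrightarrow> (\<exists>a b. i \<le> a \<and> jump a b j)"

lemma skips_less: "skips i j \<Longrightarrow> i + 2 \<le> j \<and> j \<le> d"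
  unfolding skips_def using jump_less by (fastforce simp: jump_def)

lemma open_interval_image: "open_interval C i j = (\<lambda>k. C ! k) ` {i<..<j}"
  by (auto simp: open_interval_def)

lemma C_in_open_interval_iff:
  "k \<le> d \<Longrightarrow> j \<le> Suc d \<Longrightarrow> C ! k \<in> open_interval C i j \<longleftrightarrow> i < k \<and> k < j"
proof -
  assume k: "k \<le> d" "j \<le> Suc d"
  show ?thesis
  proof
    assume "C ! k \<in> open_interval C i j"
    then obtain m where m: "C ! k = C ! m" "i < m" "m < j" by (auto simp: open_interval_def)
    then have "k = m" using C_inj[of k m] k by simp
    then show "i < k \<and> k < j" using m by simp
  qed (auto simp: open_interval_def)
qed

text \<open>The decreased position \<open>b\<close> need not be a label: the label of that step is at most \<open>b\<close>.\<close>

lemma skipped_iff: "skipped bot_word w C S \<longleftrightarrow> (\<exists>i j. skips i j \<and> S = open_interval C i j)"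
proof
  assume "skipped bot_word w C S"
  then obtain i j C' where ij: "i + 2 \<le> j" "j \<le> d" "S = open_interval C i j"
    and C': "max_chain bot_word w C'" "chain_less C' C" "set C - S \<subseteq> set C'"
    by (auto simp: skipped_def)
  from C'(1) obtain ls' where ls': "admissible_seq w ls'" "C' = chain_of w ls'"
    "bot_word = nonzeros (foldl decr w ls')"
    using max_chain_conv[OF pos] by blast
  interpret C': labelled_chain w ls' by unfold_locales (fact pos ls'(1))+
  have len: "length ls' = d"
    using C'.sum_E[of "length ls'"] sum_E[of d] ls'(3)
    by (metis C'.E_def add_left_imp_eq order_refl sum_list_nonzeros take_all)
  have in_C': "C' ! k = C ! k" if k: "k \<le> d" "C ! k \<in> set C'" for k
  proof -
    obtain m where "m \<le> d" "C' ! m = C ! k"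
      using k(2) by (auto simp: ls'(2) C'.set_C len)
    moreover from this have "m = k"
      using C'.sum_C[of m] sum_C[OF k(1)] by (simp add: ls'(2) len)
    ultimately show ?thesis by simp
  qed
  have "(ls', ls) \<in> lexord less_than"
    using C'(2) by (simp add: chain_less_def ls' chain_labels_chain_of pos adm)
  \<comment> \<open>Equal lengths exclude a proper prefix, so there is a first step \<open>a\<close>
    at which the labels differ.\<close>
  then obtain U x y V W where UVW: "ls' = U @ x # V" "ls = U @ y # W" "x < y"
    using len by (auto simp: lexord_def)
  define a where "a = length U"
  have a: "a < d" "ls ! a = y" "ls' ! a = x" by (simp_all add: UVW a_def)
  have Ea: "C'.E a = E a" unfolding E_def C'.E_def by (simp add: UVW a_def)
  have x: "admissible (E a) x" "C' ! Suc a = nonzeros (decr (E a) x)" "Suc a \<le> length ls'"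
    using C'.admissible_E[of a] C'.C_nth[of "Suc a"] C'.E_Suc[of a] a Ea len by (simp_all add: ls'(2))
  \<comment> \<open>The chains part right after \<open>a\<close>, so the next element of
    \<open>C\<close> is among those left out, which places \<open>a\<close> inside the interval. The
    element \<open>v_j\<close> is not left out and hence shared.\<close>
  have "C ! Suc a \<noteq> C' ! Suc a"
    using C_nth[of "Suc a"] E_Suc[OF a(1)] x admissible_inj[OF x(1) admissible_E[OF a(1)]] a UVW(3)
    by auto
  then have "C ! Suc a \<notin> set C'" using in_C'[of "Suc a"] a by auto
  moreover have "C ! Suc a \<in> set C" using a by (auto simp: set_C)
  ultimately have "C ! Suc a \<in> S" using C'(3) by blast
  then have aij: "i \<le> a" "Suc a < j"
    using C_in_open_interval_iff[of "Suc a" j i] a ij by auto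
  have "C ! j \<in> set C - S" using C_in_open_interval_iff[of j j i] ij by (auto simp: set_C)
  then have "C' ! j = C ! j" using C'(3) in_C' ij by blast
  then have "nonzeros (C'.E j) = nonzeros (E j)"
    using C_nth[of j] C'.C_nth[of j] ij len by (simp add: ls'(2))
  moreover have "emb (nonzeros (C'.E j)) (nonzeros (C'.E (Suc a)))"
    using C'.emb_E[of "Suc a" j] aij ij len by simp
  moreover have "C'.E (Suc a) = decr (E a) x" using C'.E_Suc[of a] a Ea len by simp
  ultimately have "jump a x j"
    using x(1) a UVW(3) aij ij by (simp add: jump_def admissible_def)
  then show "\<exists>i j. skips i j \<and> S = open_interval C i j" using aij ij(3) skips_def by blast
next
  assume "\<exists>i j. skips i j \<and> S = open_interval C i j"
  then obtain i j a b where S: "S = open_interval C i j" and ij: "i + 2 \<le> j" "j \<le> d"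
    and a: "i \<le> a" "jump a b j"
    using skips_less unfolding skips_def by blast
  have ad: "a < d" "a < j" using a(2) by (auto simp: jump_def)
  have b: "b < ls ! a" "b < length (E a)" "0 < E a ! b"
    using a(2) label_less[OF ad(1)] by (auto simp: jump_def)
  obtain b' where b': "b' \<le> b" "admissible (E a) b'" "nonzeros (decr (E a) b') = nonzeros (decr (E a) b)"
    using admissible_exists[OF b(2,3)] by blast
  have "emb (nonzeros (E j)) (nonzeros (decr (E a) b'))" using a(2) b' by (simp add: jump_def)
  then obtain ls2 where ls2: "admissible_seq (decr (E a) b') ls2"
    "nonzeros (foldl decr (decr (E a) b') ls2) = nonzeros (E j)"
    using emb_admissible_seq nonzeros_in_pos_words by metis
  define F where "F = foldl decr (decr (E a) b') ls2"
  have F: "nonzeros F = C ! j" using ls2(2) ij by (simp add: F_def C_nth)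
  have dropC: "drop j C = nonzeros F # drop (Suc j) C"
    using F ij by (simp add: Cons_nth_drop_Suc)
  have "C = take j C @ drop j C" by simp
  then have "successively covers (drop j C)"
    using successively_chain_of[OF adm] by (metis successively_append_iff)
  \<comment> \<open>Below \<open>v_j\<close> the words of \<open>C\<close> are kept but labelled
    anew, since \<open>F\<close> and \<open>E j\<close> may be different expansions of
    \<open>v_j\<close>.\<close>
  then obtain ls3 where ls3: "admissible_seq F ls3" "chain_of F ls3 = drop j C"
    using chain_of_labels_from[of F "drop (Suc j) C"] dropC by auto
  define ls' where "ls' = take a ls @ b' # ls2 @ ls3"
  have "admissible_seq w (take a ls)"
    using adm admissible_seq_append[of w "take a ls" "drop a ls"] by simp
  with b'(2) ls2(1) ls3(1) have adm': "admissible_seq w ls'"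
    by (simp add: ls'_def admissible_seq_append E_def F_def)
  have fin: "foldl decr w ls' = foldl decr F ls3" by (simp add: ls'_def F_def E_def)
  have "nonzeros (foldl decr w ls') = last (drop j C)"
    using fin ls3(2) last_chain_of by metis
  also have "\<dots> = bot_word" using C_nth[of d] ij by (simp add: last_conv_nth)
  finally have max': "max_chain bot_word w (chain_of w ls')"
    using adm' max_chain_conv[OF pos] by metis
  have "ls = take a ls @ ls ! a # drop (Suc a) ls" using ad by (simp add: id_take_nth_drop)
  then have "(ls', ls) \<in> lexord less_than"
    using b'(1) b(1) lexord_append_left_rightI[of b' "ls ! a" less_than "take a ls" "ls2 @ ls3"
        "drop (Suc a) ls"] by (metis ls'_def le_less_trans less_than_iff)
  then have less': "chain_less (chain_of w ls') C"
    by (simp add: chain_less_def chain_labels_chain_of pos adm adm')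
  have "C ! k \<in> set (chain_of w ls')" if "k \<le> d" "k \<le> i \<or> j \<le> k" for k
    using that(2)
  proof
    assume "k \<le> i"
    then have "chain_of w ls' ! k = C ! k"
      using a ad by (simp add: nth_chain_of ls'_def min_def)
    moreover have "k < length (chain_of w ls')" using \<open>k \<le> i\<close> a ad by (simp add: ls'_def)
    ultimately show ?thesis by (metis nth_mem)
  next
    assume "j \<le> k"
    have "drop j C ! (k - j) = C ! k" "k - j < length (drop j C)"
      using \<open>j \<le> k\<close> that(1) by simp_all
    then have "C ! k \<in> set (drop j C)" by (metis nth_mem)
    then have "C ! k \<in> set (chain_of F ls3)" by (simp add: ls3(2))
    moreover have "foldl decr w (take a ls @ b' # ls2) = F" by (simp add: F_def E_def)
    then have "chain_of w ls' = butlast (chain_of w (take a ls @ b' # ls2)) @ chain_of F ls3"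
      using chain_of_append[of w "take a ls @ b' # ls2" ls3] by (simp add: ls'_def)
    ultimately show ?thesis by simp
  qed
  then have "set C - S \<subseteq> set (chain_of w ls')"
    using S ij C_in_open_interval_iff[of _ j i] by (fastforce simp: set_C)
  then show "skipped bot_word w C S"
    unfolding skipped_def using max' less' ij S by (auto simp: less_Suc_eq_le)
qed

section \<open>Minimal skipped intervals as pairs of indices\<close>

definition min_skip :: "nat \<Rightarrow> nat \<Rightarrow> bool" where
  "min_skip i j \<longleftrightarrow> skips i j \<and> (\<forall>i' j'. skips i' j' \<longrightarrow> i \<le> i' \<longrightarrow> j' \<le> j \<longrightarrow> i' = i \<and> j' = j)"

lemma open_interval_subset_iff:
  assumes "i + 2 \<le> j" "j \<le> d" "j' \<le> d"
  shows "open_interval C i j \<subseteq> open_interval C i' j' \<longleftrightarrow> i' \<le> i \<and> j \<le> j'"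
proof
  assume *: "open_interval C i j \<subseteq> open_interval C i' j'"
  have "C ! Suc i \<in> open_interval C i j" "C ! (j - 1) \<in> open_interval C i j"
    using assms by (auto simp: C_in_open_interval_iff)
  then have "C ! Suc i \<in> open_interval C i' j'" "C ! (j - 1) \<in> open_interval C i' j'"
    using * by auto
  then show "i' \<le> i \<and> j \<le> j'"
    using assms by (auto simp: C_in_open_interval_iff)
qed (auto simp: open_interval_image)

lemma MSIs_conv: "MSIs bot_word w C = {open_interval C i j | i j. min_skip i j}"
proof (intro equalityI subsetI)
  fix S assume S: "S \<in> MSIs bot_word w C"
  then obtain i j where ij: "skips i j" "S = open_interval C i j"
    by (auto simp: MSIs_def skipped_iff)
  have "i' = i \<and> j' = j" if "skips i' j'" "i \<le> i'" "j' \<le> j" for i' j'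
  proof -
    have "skipped bot_word w C (open_interval C i' j')" using that skipped_iff by blast
    then have "\<not> open_interval C i' j' \<subset> S" using S by (auto simp: MSIs_def)
    moreover have "open_interval C i' j' \<subseteq> S"
      using that by (auto simp: ij open_interval_image)
    ultimately have "open_interval C i j \<subseteq> open_interval C i' j'" using ij by blast
    then show ?thesis
      using open_interval_subset_iff[of i j j' i'] skips_less[OF ij(1)] skips_less[OF that(1)] that
      by auto
  qed
  then show "S \<in> {open_interval C i j | i j. min_skip i j}"
    using ij by (auto simp: min_skip_def)
next
  fix S assume "S \<in> {open_interval C i j | i j. min_skip i j}"
  then obtain i j where ij: "min_skip i j" "S = open_interval C i j" by blast
  have "\<not> T \<subset> S" if T: "skipped bot_word w C T" for T
  proof
    assume TS: "T \<subset> S"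
    obtain i' j' where i'j': "skips i' j'" "T = open_interval C i' j'" using T skipped_iff by blast
    have "i \<le> i' \<and> j' \<le> j"
      using open_interval_subset_iff[of i' j' j i] TS ij i'j' skips_less
      by (auto simp: min_skip_def)
    then have "T = S" using ij i'j' by (auto simp: min_skip_def)
    then show False using TS by simp
  qed
  then show "S \<in> MSIs bot_word w C"
    using ij by (auto simp: MSIs_def skipped_iff min_skip_def)
qed

lemma set_MSI_list: "set (MSI_list bot_word w C) = MSIs bot_word w C"
proof (intro equalityI subsetI)
  fix S assume "S \<in> MSIs bot_word w C"
  moreover then obtain i j where "min_skip i j" "S = open_interval C i j"
    by (auto simp: MSIs_conv)
  moreover then have "i + 2 \<le> j" "j < length C"
    using skips_less by (force simp: min_skip_def)+
  ultimately show "S \<in> set (MSI_list bot_word w C)"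
    by (fastforce simp: MSI_list_def simp del: length_chain_of)
qed (auto simp: MSI_list_def)

end

text \<open>Removing \<open>I\<close> does not change a set disjoint from it and turns a further
  copy of \<open>I\<close> into the empty set, which \<open>prune\<close> drops. Disjoint nonempty
  sets never strictly contain each other, so nothing else is lost.\<close>

lemma set_disjointify:
  assumes "\<And>S. S \<in> set Is \<Longrightarrow> S \<noteq> {}"
    and "\<And>S T. S \<in> set Is \<Longrightarrow> T \<in> set Is \<Longrightarrow> S \<noteq> T \<Longrightarrow> S \<inter> T = {}"
  shows "set (disjointify Is) = set Is"
  using assms
proof (induction Is rule: disjointify.induct)
  case (2 I Is)
  have diff: "S - I = (if S = I then {} else S)" if "S \<in> set Is" for S
    using 2(3)[of S I] that by auto
  have "set (prune (map (\<lambda>S. S - I) Is)) = set Is - {I}"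
  proof -
    have "map (\<lambda>S. S - I) Is = map (\<lambda>S. if S = I then {} else S) Is"
      using diff by simp
    moreover have "\<not> T \<subset> S" if "S \<in> set Is" "T \<in> set Is" for S T
      using 2(2)[of T] 2(3)[of S T] that by auto
    moreover have "{} \<notin> set Is" using 2(2)[of "{}"] by auto
    ultimately show ?thesis unfolding prune_def by auto
  qed
  moreover have "set (disjointify (prune (map (\<lambda>S. S - I) Is))) = set (prune (map (\<lambda>S. S - I) Is))"
    by (rule 2(1)) (use 2(2,3) calculation in auto)
  ultimately show ?case by auto
qed simp

text \<open>Sets are only shrunk or discarded. Hence a critical chain is also covered by its minimal
  skipped intervals themselves.\<close>

lemma Union_disjointify: "\<Union> (set (disjointify Is)) \<subseteq> \<Union> (set Is)"
proof (induction Is rule: disjointify.induct)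
  case (2 I Is)
  have "\<Union> (set (prune (map (\<lambda>S. S - I) Is))) \<subseteq> \<Union> (set Is)" by (auto simp: prune_def)
  with 2 show ?case by auto
qed simp

section \<open>The shape of minimal skipped intervals\<close>

lemma decr_append: "b < length A \<Longrightarrow> decr (A @ B) b = decr A b @ B"
  by (simp add: decr_def list_update_append nth_append)

lemma decr_commute: "decr (decr e a) b = decr (decr e b) a"
  by (cases "a < length e"; cases "b < length e"; cases "a = b")
     (auto simp: decr_def list_update_swap)

lemma emb_appendD1: "emb (u @ v) w \<Longrightarrow> emb u w"
  by (metis emb_refl emb_trans list_emb_prefix)

context labelled_chain
begin

lemma E_split: "q < length w \<Longrightarrow> E k = take q (E k) @ E k ! q # drop (Suc q) (E k)"
  by (simp add: id_take_nth_drop)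

lemma min_skip_jump:
  assumes "min_skip i j"
  obtains b where "jump i b j"
proof -
  from assms obtain a b where "i \<le> a" "jump a b j" by (auto simp: min_skip_def skips_def)
  moreover then have "a = i" using assms unfolding min_skip_def skips_def by blast
  ultimately show ?thesis using that by blast
qed

text \<open>The last label \<open>q\<close> is the largest, so the entries right of \<open>q\<close>
  stay equal to \<open>T\<close>, and once label \<open>q\<close> has occurred the entries left of
  it stay equal to \<open>Y\<close>. After cancelling \<open>T\<close>, the jump embeds
  \<open>Y\<close> and the final entry at \<open>q\<close> into \<open>decr X b\<close> and
  \<open>x\<close>. Minimality prevents \<open>Y\<close> from fitting into \<open>decr X b\<close>
  alone; so the last letter of \<open>Y\<close> needs \<open>x\<close>, and no room is left for a
  final entry at \<open>q\<close>.\<close>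

lemma min_skip_ascending:
  assumes ms: "min_skip i j" and asc: "\<And>k. i < k \<Longrightarrow> k < j \<Longrightarrow> ls ! (k - 1) \<le> ls ! k"
  obtains q Y where "q < length w" "\<And>k. i \<le> k \<Longrightarrow> k < j \<Longrightarrow> ls ! k = q" "E j ! q = 0"
    "nonzeros (take q (E i)) = Y @ [E i ! q]" "2 \<le> E i ! q"
proof -
  obtain b where jump: "jump i b j" using min_skip_jump[OF ms] .
  have ij: "i + 2 \<le> j" "j \<le> d" using jump_less[OF jump] jump by (auto simp: jump_def)
  have minim: "a = i" if "jump a b' j'" "i \<le> a" "j' \<le> j" for a b' j'
    using ms that unfolding min_skip_def skips_def by blast
  have minim2: "j' = j" if "jump a b' j'" "i \<le> a" "j' \<le> j" for a b' j'
    using ms that unfolding min_skip_def skips_def by blast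
  have mono: "ls ! k \<le> ls ! k'" if "i \<le> k" "k \<le> k'" "k' < j" for k k'
    using that(2,3,1)
  proof (induction k' rule: dec_induct)
    case (step n)
    then show ?case using asc[of "Suc n"] by simp
  qed simp
  define q where "q = ls ! (j - 1)"
  have q: "q < length w" using label_less ij by (simp add: q_def)
  have bi: "b < ls ! i" "0 < E i ! b" using jump by (auto simp: jump_def)
  moreover have "ls ! i \<le> q" unfolding q_def by (rule mono) (use ij in auto)
  ultimately have bq: "b < q" by simp
  \<comment> \<open>The first step with label \<open>q\<close>; by monotonicity all later steps of
    the interval have this label too.\<close>
  define m where "m = (LEAST k. i \<le> k \<and> ls ! k = q)"
  have m: "i \<le> m" "ls ! m = q" "m \<le> j - 1"
    using LeastI[of "\<lambda>k. i \<le> k \<and> ls ! k = q" "j - 1"] Least_le[of "\<lambda>k. i \<le> k \<and> ls ! k = q" "j - 1"] ij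
    by (simp_all add: m_def q_def)
  have mj: "m < j" using m ij by simp
  have before: "ls ! k < q" if "i \<le> k" "k < m" for k
  proof -
    have "ls ! k \<noteq> q" using not_less_Least[of k "\<lambda>k. i \<le> k \<and> ls ! k = q"] that by (auto simp: m_def)
    moreover have "ls ! k \<le> q" using mono[of k m] that m mj by simp
    ultimately show ?thesis by simp
  qed
  have after: "ls ! k = q" if "m \<le> k" "k < j" for k
    using mono[of m k] mono[of k "j - 1"] that m ij by (simp add: q_def)
  define X Y T x where "X = take q (E i)" and "Y = take q (E j)"
    and "T = drop (Suc q) (E i)" and "x = E i ! q"
  have lenX: "length X = q" and lenY: "length Y = q" using q by (simp_all add: X_def Y_def)
  have drop_eq: "drop (Suc q) (E k) = T" if "i \<le> k" "k \<le> j" for k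
    unfolding T_def
  proof (rule nth_equalityI)
    fix p assume "p < length (drop (Suc q) (E k))"
    have "E k ! (Suc q + p) = E i ! (Suc q + p)"
    proof (rule E_nth_unchanged)
      fix n assume "i \<le> n" "n < k"
      then have "ls ! n \<le> q" using mono[of n "j - 1"] that by (simp add: q_def)
      then show "ls ! n \<noteq> Suc q + p" by simp
    qed (use that ij in auto)
    then show "drop (Suc q) (E k) ! p = drop (Suc q) (E i) ! p"
      using \<open>p < _\<close> by (simp add: nth_drop)
  qed simp
  have take_eq: "take q (E k) = Y" if "m \<le> k" "k \<le> j" for k
    unfolding Y_def
  proof (rule nth_equalityI)
    fix p assume "p < length (take q (E k))"
    then have p: "p < q" by simp
    have "E j ! p = E k ! p"
      by (rule E_nth_unchanged) (use that ij after p in auto)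
    then show "take q (E k) ! p = take q (E j) ! p" using p by simp
  qed simp
  have Em: "E m ! q = x" unfolding x_def
    by (rule E_nth_unchanged) (use m ij before in force)+
  have x_pos: "0 < x" using E_label_pos[of m] m ij Em by simp
  have Ek: "E k = Y @ E k ! q # T" if "m \<le> k" "k \<le> j" for k
    using E_split[OF q, of k] take_eq[OF that] drop_eq that m by simp
  have Ei: "E i = X @ x # T" using E_split[OF q, of i] by (simp add: X_def x_def T_def)
  have Eib: "nonzeros (decr (E i) b) = (nonzeros (decr X b) @ [x]) @ nonzeros T"
    unfolding Ei using bq x_pos by (simp add: decr_append lenX nonzeros_Cons)
  have Yj: "nonzeros (E j) = (nonzeros Y @ nonzeros [E j ! q]) @ nonzeros T"
    by (subst Ek[of j]) (use mj in \<open>auto simp: nonzeros_Cons\<close>)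
  have "emb (nonzeros (E j)) (nonzeros (decr (E i) b))" using jump by (simp add: jump_def)
  then have emb: "emb (nonzeros Y @ nonzeros [E j ! q]) (nonzeros (decr X b) @ [x])"
    unfolding Yj Eib emb_append_cancel .
  \<comment> \<open>Otherwise the interval could already end before the steps with label \<open>q\<close>.\<close>
  have N: "\<not> emb (nonzeros Y) (nonzeros (decr X b))"
  proof
    assume e: "emb (nonzeros Y) (nonzeros (decr X b))"
    have Ykm: "nonzeros (E m) = (nonzeros Y @ [x]) @ nonzeros T"
      by (subst Ek[of m]) (use mj Em x_pos in \<open>auto simp: nonzeros_Cons\<close>)
    have "emb (nonzeros (E m)) (nonzeros (decr (E i) b))"
      unfolding Ykm Eib emb_append_cancel by (fact e)
    show False
    proof (cases "i = m")
      \<comment> \<open>With no step before label \<open>q\<close>, the left part has not changed,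
        and \<open>decr X b\<close> is too small to contain it.\<close>
      case True
      then have "X = Y" using take_eq[of m] mj by (simp add: X_def)
      moreover have "X ! b = E i ! b" using bq by (simp add: X_def)
      ultimately show False
        using list_emb_sum_list[OF e] sum_list_decr[of b X] bq lenX bi by simp
    next
      case False
      then have "jump i b m"
        using m mj ij bi \<open>emb (nonzeros (E m)) _\<close> by (simp add: jump_def)
      then show False using minim2[of i b m] mj by simp
    qed
  qed
  have yx: "E j ! q \<le> x" using E_nth_antimono[of i j q] ij by (simp add: x_def)
  have y0: "E j ! q = 0"
  proof (rule ccontr)
    assume "E j ! q \<noteq> 0"
    then have "emb (nonzeros Y @ [E j ! q]) (nonzeros (decr X b) @ [x])"
      using emb by (simp add: nonzeros_Cons)
    then show False using N emb_appendD1 unfolding emb_snoc_iff by blast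
  qed
  \<comment> \<open>All labels of the interval exceed \<open>b\<close>, so the nonzero entry at
    \<open>b\<close> survives and \<open>Y\<close> has a last letter.\<close>
  have Yb: "Y ! b = E i ! b"
  proof -
    have "E j ! b = E i ! b"
    proof (rule E_nth_unchanged)
      fix n assume "i \<le> n" "n < j"
      then show "ls ! n \<noteq> b" using mono[of i n] bi by simp
    qed (use ij in auto)
    then show ?thesis using bq by (simp add: Y_def)
  qed
  have "nonzeros Y \<noteq> []"
  proof -
    have "Y ! b \<in> set Y" using bq lenY by simp
    then have "Y ! b \<in> set (nonzeros Y)" using Yb bi by (simp add: nonzeros_def)
    then show ?thesis by auto
  qed
  then obtain Y0 z where Yz: "nonzeros Y = Y0 @ [z]" by (metis rev_exhaust)
  have "z \<in> set (nonzeros Y)" by (simp add: Yz)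
  then have z0: "z \<noteq> 0" by (simp add: nonzeros_def)
  \<comment> \<open>The step to \<open>v_j\<close> deletes a 1 at \<open>q\<close>, and
    admissibility forbids a 1 as the preceding letter.\<close>
  have z1: "z \<noteq> 1"
  proof -
    have "E (j - 1) ! q - 1 = 0" "0 < E (j - 1) ! q"
      using E_nth_Suc[of "j - 1" q] E_label_pos[of "j - 1"] y0 ij by (simp_all add: q_def)
    then have "E (j - 1) ! q = 1" by simp
    moreover have "take q (E (j - 1)) = Y" using take_eq m by simp
    moreover have "admissible (E (j - 1)) q" using admissible_E[of "j - 1"] ij by (simp add: q_def)
    ultimately show ?thesis by (auto simp: admissible_def Yz)
  qed
  have "emb (Y0 @ [z]) (nonzeros (decr X b) @ [x])" using emb y0 Yz by (simp add: nonzeros_Cons)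
  then have zx: "z \<le> x" using N unfolding emb_snoc_iff Yz by blast
  obtain A B where AB: "Y = A @ z # B" "nonzeros A = Y0" "nonzeros B = []"
    using nonzeros_split[of Y Y0 z "[]"] Yz by blast
  \<comment> \<open>The entry at \<open>q\<close> can take over the role of the preceding letter \<open>z\<close>, so decreasing
    that letter instead also leads to \<open>E j\<close>.\<close>
  have skip: "jump k (length A) j" if "m \<le> k" "k < j" "z \<le> E k ! q" for k
  proof -
    have Aq: "length A < q" using AB lenY by auto
    have E: "E k = Y @ E k ! q # T" using Ek that by simp
    have "decr (E k) (length A) = (A @ (z - 1) # B) @ E k ! q # T"
      by (subst E) (simp add: AB decr_split)
    then have 1: "nonzeros (decr (E k) (length A))
        = ((Y0 @ nonzeros [z - 1]) @ [E k ! q]) @ nonzeros T"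
      using that z0 AB by (simp add: nonzeros_Cons)
    have "nonzeros (E j) = (Y0 @ [z]) @ nonzeros T"
      by (subst Ek[of j]) (use mj y0 Yz in \<open>auto simp: nonzeros_Cons\<close>)
    moreover have "emb Y0 (Y0 @ nonzeros [z - 1])" by (rule list_emb_prefix) simp
    then have "emb (Y0 @ [z]) ((Y0 @ nonzeros [z - 1]) @ [E k ! q])"
      using that emb_snoc_iff by blast
    ultimately have "emb (nonzeros (E j)) (nonzeros (decr (E k) (length A)))"
      by (simp only: 1 emb_append_cancel)
    moreover have "E k ! length A = z" by (subst E) (simp add: AB nth_append)
    ultimately show ?thesis using that Aq z0 ij after by (simp add: jump_def)
  qed
  have mi: "m = i" using minim[OF skip[of m]] m mj zx Em by simp
  \<comment> \<open>If \<open>z < x\<close>, the entry at \<open>q\<close> is at least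
    \<open>z\<close> even after one step, so a jump could start at \<open>i + 1\<close>.\<close>
  have "z = x"
  proof (rule ccontr)
    assume "z \<noteq> x"
    then have "z \<le> E (Suc i) ! q"
      using zx E_nth_Suc[of i q] ij by (auto simp: x_def)
    then have "jump (Suc i) (length A) j" using skip[of "Suc i"] mi ij by simp
    then show False using minim[of "Suc i" "length A" j] by simp
  qed
  show ?thesis
  proof (rule that[of q Y0])
    show "nonzeros (take q (E i)) = Y0 @ [E i ! q]"
      using take_eq[of m] mi mj Yz \<open>z = x\<close> by (simp add: x_def)
    show "2 \<le> E i ! q" using z0 z1 \<open>z = x\<close> by (simp add: x_def)
  qed (use q after mi y0 in auto)
qed

text \<open>Decreases at two different positions commute, and doing the one with the smaller label
  first is a jump. The interval is minimal because every skipped interval has an inner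
  element.\<close>

lemma descent_min_skip:
  assumes "Suc k < d" "ls ! Suc k < ls ! k"
  shows "min_skip k (k + 2)"
proof -
  have k: "k < d" using assms by simp
  have 0: "0 < E k ! (ls ! Suc k)"
    using E_label_pos[OF assms(1)] E_nth_Suc[OF k] assms(2) by simp
  have l: "ls ! k < length w" "ls ! Suc k < length w" using label_less assms k by auto
  have "E (k + 2) = decr (decr (E k) (ls ! k)) (ls ! Suc k)"
    using assms k by (simp add: E_Suc)
  also have "\<dots> = decr (decr (E k) (ls ! Suc k)) (ls ! k)" by (rule decr_commute)
  finally have "emb (nonzeros (E (k + 2))) (nonzeros (decr (E k) (ls ! Suc k)))"
    using emb_decr[of "ls ! k" "decr (E k) (ls ! Suc k)"] l assms(2) E_label_pos[OF k]
    by (simp add: nth_decr)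
  then have "jump k (ls ! Suc k) (k + 2)" using assms 0 by (simp add: jump_def)
  then have "skips k (k + 2)" by (auto simp: skips_def)
  then show ?thesis using skips_less unfolding min_skip_def by force
qed

text \<open>A descent within the interval is itself a minimal skipped interval and therefore all of
  it; without descents the labels increase weakly.\<close>

lemma min_skip_cases:
  assumes "min_skip i j"
  obtains "j = i + 2" "ls ! Suc i < ls ! i"
    | q Y where "q < length w" "\<And>k. i \<le> k \<Longrightarrow> k < j \<Longrightarrow> ls ! k = q" "E j ! q = 0"
        "nonzeros (take q (E i)) = Y @ [E i ! q]" "2 \<le> E i ! q"
proof (cases "\<exists>k. i \<le> k \<and> Suc k < j \<and> ls ! Suc k < ls ! k")
  case True
  then obtain k where k: "i \<le> k" "Suc k < j" "ls ! Suc k < ls ! k" by blast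
  have "j \<le> d" using assms skips_less by (auto simp: min_skip_def)
  then have "min_skip k (k + 2)" using k by (intro descent_min_skip) auto
  then have "k = i \<and> k + 2 = j" using assms k unfolding min_skip_def by force
  then show ?thesis using k that(1) by blast
next
  case False
  have "ls ! (k - 1) \<le> ls ! k" if "i < k" "k < j" for k
  proof -
    have "i \<le> k - 1" "Suc (k - 1) = k" using that by auto
    then show ?thesis using False that by (metis not_less)
  qed
  from min_skip_ascending[OF assms this] show ?thesis using that(2) by metis
qed

end

section \<open>Normal embeddings\<close>

text \<open>Normality position by position: whether \<open>q\<close> is the start of a run of
  \<open>w\<close> depends only on its left neighbour.\<close>

definition locally_normal :: "nat list \<Rightarrow> nat list \<Rightarrow> nat \<Rightarrow> bool" where
  "locally_normal e w q \<longleftrightarrow> e ! q \<in> {w ! q, w ! q - 1, 0} \<and>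
     (w ! q = 1 \<and> e ! q = 0 \<longrightarrow> q = 0 \<or> w ! (q - 1) \<noteq> 1) \<and>
     (w ! q \<ge> 2 \<and> e ! q = 0 \<longrightarrow> 0 < q \<and> w ! (q - 1) = w ! q)"

lemma is_normal_iff:
  "is_normal e u w \<longleftrightarrow> is_embedding e u w \<and> (\<forall>q < length w. locally_normal e w q)"
proof
  assume n: "is_normal e u w"
  have "locally_normal e w q" if q: "q < length w" for q
    unfolding locally_normal_def
  proof (intro conjI impI)
    show "e ! q \<in> {w ! q, w ! q - 1, 0}" using n q by (auto simp: is_normal_def)
  next
    assume a: "w ! q = 1 \<and> e ! q = 0"
    show "q = 0 \<or> w ! (q - 1) \<noteq> 1"
    proof (rule ccontr)
      assume "\<not> ?thesis"
      then have c: "0 < q" "w ! (q - 1) = 1" by auto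
      let ?P = "\<lambda>r. r \<le> q \<and> (\<forall>i\<in>{r..q}. w ! i = 1)"
      define r where "r = (LEAST r. ?P r)"
      have "{q - 1..q} = {q - 1, q}" using c by auto
      then have Pq: "?P (q - 1)" using a c by auto
      have r: "?P r" "r \<le> q - 1"
        unfolding r_def by (rule LeastI[of ?P, OF Pq], rule Least_le[of ?P, OF Pq])
      have "r = 0 \<or> w ! (r - 1) \<noteq> 1"
      proof (rule ccontr)
        assume b: "\<not> ?thesis"
        moreover have "{r - 1..q} \<subseteq> insert (r - 1) {r..q}" by auto
        ultimately have "?P (r - 1)" using r by auto
        then have "r \<le> r - 1" unfolding r_def by (rule Least_le)
        moreover have "0 < r" using b by simp
        ultimately show False by linarith
      qed
      then obtain t where "is_run 1 w r t" "q \<le> t"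
        using is_run_extend[of r q w 1] r q by blast
      then have "e ! q \<noteq> 0" using n r c by (auto simp: is_normal_def)
      then show False using a by simp
    qed
  next
    assume a: "w ! q \<ge> 2 \<and> e ! q = 0"
    show "0 < q" "w ! (q - 1) = w ! q"
    proof -
      have "\<not> (q = 0 \<or> w ! (q - 1) \<noteq> w ! q)"
      proof
        assume "q = 0 \<or> w ! (q - 1) \<noteq> w ! q"
        then obtain t where "is_run (w ! q) w q t"
          using is_run_extend[of q q w "w ! q"] q by auto
        then show False using n a unfolding is_normal_def by blast
      qed
      then show "0 < q" "w ! (q - 1) = w ! q" by auto
    qed
  qed
  then show "is_embedding e u w \<and> (\<forall>q < length w. locally_normal e w q)"
    using n by (auto simp: is_normal_def)
next
  assume *: "is_embedding e u w \<and> (\<forall>q < length w. locally_normal e w q)"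
  have "(k = 1 \<longrightarrow> (\<forall>i \<in> {r<..t}. e ! i \<noteq> 0)) \<and> (k \<ge> 2 \<longrightarrow> e ! r \<noteq> 0)"
    if run: "is_run k w r t" for k r t
  proof (intro conjI impI ballI)
    fix i assume k: "k = 1" and i: "i \<in> {r<..t}"
    have "i - 1 \<in> {r..t}" "i \<in> {r..t}" "0 < i" using i by auto
    then have "i < length w" "w ! i = 1" "w ! (i - 1) = 1" "0 < i"
      using run k unfolding is_run_def by auto
    then show "e ! i \<noteq> 0" using * by (auto simp: locally_normal_def)
  next
    assume k: "k \<ge> 2"
    have "r < length w" "w ! r = k" using run by (auto simp: is_run_def)
    then show "e ! r \<noteq> 0" using * is_run_start[OF run] k by (auto simp: locally_normal_def)
  qed
  then show "is_normal e u w" using * by (auto simp: is_normal_def locally_normal_def)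
qed

section \<open>Weakly decreasing chains\<close>

locale decreasing_chain = labelled_chain +
  assumes dec: "sorted_wrt (\<ge>) ls"
begin

lemma dec_nth: "k \<le> m \<Longrightarrow> m < d \<Longrightarrow> ls ! m \<le> ls ! k"
  using sorted_wrt_nth_less[OF dec, of k m] by (cases "k = m") auto

text \<open>The steps with label \<open>q\<close> are those in \<open>{lo q..<hi q}\<close>.\<close>

definition lo :: "nat \<Rightarrow> nat" where
  "lo q = (LEAST k. k = d \<or> ls ! k \<le> q)"

definition hi :: "nat \<Rightarrow> nat" where
  "hi q = (LEAST k. k = d \<or> ls ! k < q)"

lemma lo_le: "lo q \<le> d" and hi_le: "hi q \<le> d"
  unfolding lo_def hi_def by (simp_all add: Least_le)

text \<open>The alternative \<open>k = d\<close> in \<open>lo\<close> and \<open>hi\<close> is the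
  value taken when no label is small enough, so that the minimum always exists.\<close>

lemma less_lo_iff: "k < d \<Longrightarrow> k < lo q \<longleftrightarrow> q < ls ! k"
proof
  assume "k < d" "k < lo q"
  then show "q < ls ! k" unfolding lo_def using not_less_Least by fastforce
next
  assume k: "k < d" "q < ls ! k"
  show "k < lo q"
  proof (rule ccontr)
    assume "\<not> k < lo q"
    moreover have "lo q = d \<or> ls ! lo q \<le> q"
      unfolding lo_def by (rule LeastI[of "\<lambda>k. k = d \<or> ls ! k \<le> q" d]) simp
    ultimately show False using dec_nth[of "lo q" k] k by auto
  qed
qed

lemma less_hi_iff: "k < d \<Longrightarrow> k < hi q \<longleftrightarrow> q \<le> ls ! k"
proof
  assume "k < d" "k < hi q"
  then show "q \<le> ls ! k" unfolding hi_def using not_less_Least by fastforce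
next
  assume k: "k < d" "q \<le> ls ! k"
  show "k < hi q"
  proof (rule ccontr)
    assume "\<not> k < hi q"
    moreover have "hi q = d \<or> ls ! hi q < q"
      unfolding hi_def by (rule LeastI[of "\<lambda>k. k = d \<or> ls ! k < q" d]) simp
    ultimately show False using dec_nth[of "hi q" k] k by auto
  qed
qed

lemma lo_le_hi: "lo q \<le> hi q"
proof (rule ccontr)
  assume "\<not> lo q \<le> hi q"
  then have "hi q < lo q" "hi q < d" using lo_le[of q] by auto
  then show False using less_lo_iff[of "hi q" q] less_hi_iff[of "hi q" q] by simp
qed

lemma label_eq_iff: "k < d \<Longrightarrow> ls ! k = q \<longleftrightarrow> lo q \<le> k \<and> k < hi q"
  using less_lo_iff[of k q] less_hi_iff[of k q] by auto

text \<open>Decreasing labels work through \<open>w\<close> from right to left. Until the steps at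
  \<open>q\<close> are over, no zeros have appeared to the left of \<open>q\<close>, and the nonzero
  letter preceding it is \<open>w ! (q - 1)\<close>.\<close>

lemma E_left: "k \<le> hi q \<Longrightarrow> p < q \<Longrightarrow> E k ! p = w ! p"
proof -
  assume k: "k \<le> hi q" "p < q"
  have "E k ! p = E 0 ! p"
  proof (rule E_nth_unchanged)
    fix n assume "n < k"
    then show "ls ! n \<noteq> p" using k less_hi_iff[of n q] hi_le[of q] by auto
  qed (use k hi_le[of q] in auto)
  then show ?thesis by simp
qed

lemma E_lo: "E (lo q) ! q = w ! q"
proof -
  have "E (lo q) ! q = E 0 ! q"
  proof (rule E_nth_unchanged)
    fix n assume "n < lo q"
    then show "ls ! n \<noteq> q" using less_lo_iff[of n q] lo_le[of q] by auto
  qed (auto simp: lo_le hi_le)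
  then show ?thesis by simp
qed

lemma E_hi: "E (hi q) ! q = E d ! q"
proof -
  have "E d ! q = E (hi q) ! q"
  proof (rule E_nth_unchanged)
    fix n assume "hi q \<le> n" "n < d"
    then show "ls ! n \<noteq> q" using label_eq_iff[of n q] by auto
  qed (auto simp: lo_le hi_le)
  then show ?thesis by simp
qed

lemma hi_eq: "E d ! q + (hi q - lo q) = w ! q"
proof -
  have "E (hi q) ! q + (hi q - lo q) = E (lo q) ! q"
  proof (rule E_nth_const_label)
    fix n assume "lo q \<le> n" "n < hi q"
    then show "ls ! n = q" using label_eq_iff[of n q] hi_le[of q] by simp
  qed (simp_all add: lo_le_hi hi_le)
  then show ?thesis by (simp add: E_lo E_hi)
qed

lemma take_E: "k \<le> hi q \<Longrightarrow> q < length w \<Longrightarrow> take q (E k) = take q w"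
  by (rule nth_equalityI) (auto simp: E_left)

lemma w_pos: "q < length w \<Longrightarrow> 0 < w ! q"
  using pos by (auto simp: pos_words_def in_lists_conv_set)

lemma nonzeros_take_w: "nonzeros (take q w) = take q w"
  using pos by (intro nonzeros_pos_words) (auto simp: pos_words_def dest: in_set_takeD)

lemma last_take_w: "q < length w \<Longrightarrow> take q w = Y @ [z] \<Longrightarrow> 0 < q \<and> w ! (q - 1) = z"
proof -
  assume q: "q < length w" and Y: "take q w = Y @ [z]"
  have "q = length (Y @ [z])" using q Y by (metis length_take min.absorb4)
  then have "0 < q" "(Y @ [z]) ! (q - 1) = z" by simp_all
  then show ?thesis unfolding Y[symmetric] by simp
qed

lemma is_embedding_E: "is_embedding (E d) bot_word w"
  unfolding is_embedding_def is_expansion_def using E_nth_antimono[of 0 d] by simp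

text \<open>The cases are the number of steps at \<open>q\<close>. With one step, admissibility puts
  a deleted 1 at the start of its run. With several, some minimal skipped interval contains an
  element between two equal labels, so it is not a descent and must be a block at
  \<open>q\<close>.\<close>

lemma cover_imp_normal:
  assumes cover: "\<And>k. 0 < k \<Longrightarrow> k < d \<Longrightarrow> \<exists>i j. min_skip i j \<and> i < k \<and> k < j"
  shows "is_normal (E d) bot_word w"
proof -
  have "locally_normal (E d) w q" if q: "q < length w" for q
  proof -
    consider "hi q - lo q = 0" | "hi q - lo q = 1" | "hi q - lo q \<ge> 2" by linarith
    then show ?thesis
    proof cases
      case 1
      then show ?thesis using hi_eq[of q] w_pos[OF q] by (auto simp: locally_normal_def)
    next
      case 2
      then have eq: "w ! q = Suc (E d ! q)" and lo: "lo q < d" "lo q < hi q"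
        using hi_eq[of q] hi_le[of q] by auto
      have "ls ! lo q = q" using label_eq_iff[of "lo q" q] lo by simp
      then have adm: "admissible (E (lo q)) q" using admissible_E[OF lo(1)] by simp
      have "q = 0 \<or> w ! (q - 1) \<noteq> 1" if "w ! q = 1"
      proof (cases "take q w" rule: rev_cases)
        case (snoc Y z)
        have "nonzeros (take q (E (lo q))) = Y @ [z]"
          using take_E[of "lo q" q] lo q nonzeros_take_w[of q] snoc by (metis less_imp_le)
        then show ?thesis
          using adm that last_take_w[OF q snoc] by (auto simp: admissible_def E_lo)
      qed (use q in auto)
      then show ?thesis using eq by (auto simp: locally_normal_def)
    next
      case 3
      then have lo: "Suc (lo q) < hi q" "Suc (lo q) < d" using hi_le[of q] by linarith+
      have lab: "ls ! lo q = q" "ls ! Suc (lo q) = q"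
        using label_eq_iff[of "lo q" q] label_eq_iff[of "Suc (lo q)" q] lo by simp_all
      \<comment> \<open>The element between the first two steps at \<open>q\<close>: an interval of
        constant label around it can only start at \<open>lo q\<close>.\<close>
      obtain i j where ij: "min_skip i j" "i < Suc (lo q)" "Suc (lo q) < j"
        using cover[of "Suc (lo q)"] lo by auto
      from ij(1) show ?thesis
      proof (cases rule: min_skip_cases)
        case 1
        then have "i = lo q" using ij by simp
        then show ?thesis using 1 lab by simp
      next
        case (2 q' Y)
        have "q' = q" using 2(2)[of "lo q"] lab ij by simp
        have "i < d" using ij lo by simp
        then have "lo q \<le> i" using 2(2)[of i] \<open>q' = q\<close> label_eq_iff[of i q] ij by simp
        then have i: "i = lo q" using ij by simp
        have j: "j \<le> d" using ij(1) skips_less by (auto simp: min_skip_def)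
        then have "E d ! q = 0" using 2(3) E_nth_antimono[of j d q] \<open>q' = q\<close> by simp
        moreover have "0 < q \<and> w ! (q - 1) = w ! q"
          using 2(4) \<open>q' = q\<close> i lo_le_hi[of q] take_E[of "lo q" q] q nonzeros_take_w[of q]
          by (intro last_take_w) (simp_all add: E_lo)
        moreover have "2 \<le> w ! q" using 2(5) \<open>q' = q\<close> i by (simp add: E_lo)
        ultimately show ?thesis by (simp add: locally_normal_def)
      qed
    qed
  qed
  then show ?thesis using is_embedding_E is_normal_iff by blast
qed

end

context labelled_chain
begin

lemma skips_imp_min_skip: "skips i j \<Longrightarrow> \<exists>i' j'. min_skip i' j' \<and> i \<le> i' \<and> j' \<le> j"
proof (induction "j - i" arbitrary: i j rule: less_induct)
  case less
  show ?case
  proof (cases "min_skip i j")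
    case False
    then obtain i' j' where *: "skips i' j'" "i \<le> i'" "j' \<le> j" "i' \<noteq> i \<or> j' \<noteq> j"
      using less.prems by (auto simp: min_skip_def)
    moreover have "j' - i' < j - i" using * skips_less[OF *(1)] by linarith
    ultimately show ?thesis using less.hyps[of j' i'] by (meson le_trans)
  qed auto
qed

end

section \<open>Decreasing chains with a normal end\<close>

locale normal_chain = decreasing_chain +
  assumes nrm: "\<And>q. q < length w \<Longrightarrow> locally_normal (E d) w q"
begin

lemma nrm_cases:
  assumes "q < length w"
  obtains "E d ! q = w ! q" | "E d ! q = w ! q - 1"
    | "E d ! q = 0" "2 \<le> w ! q" "0 < q" "w ! (q - 1) = w ! q"
proof -
  have "E d ! q \<in> {w ! q, w ! q - 1, 0}" using nrm[OF assms] by (simp add: locally_normal_def)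
  moreover have "0 < q \<and> w ! (q - 1) = w ! q" if "E d ! q = 0" "2 \<le> w ! q"
    using nrm[OF assms] that by (simp add: locally_normal_def)
  moreover have "w ! q = 1 \<or> 2 \<le> w ! q" using w_pos[OF assms] by linarith
  ultimately show ?thesis using that by fastforce
qed

text \<open>A block comprises all steps at its position. It starts at \<open>lo q\<close>, since the
  entry there equals the preceding letter, which by normality is the original \<open>w ! q\<close>;
  it ends at \<open>hi q\<close>, since the entry has become 0.\<close>

lemma min_skip_normal_cases:
  assumes "min_skip i j"
  obtains "j = i + 2" "ls ! Suc i < ls ! i"
    | q where "q < length w" "2 \<le> w ! q" "E d ! q = 0" "i = lo q" "j = hi q"
  using assms
proof (cases rule: min_skip_cases)
  case 1
  then show ?thesis by (rule that(1))
next
  case (2 q Y)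
  have ij: "i + 2 \<le> j" "j \<le> d" using assms skips_less by (auto simp: min_skip_def)
  have e0: "E d ! q = 0" using 2(3) E_nth_antimono[of j d q] ij by simp
  have w2: "2 \<le> w ! q" using 2(5) E_nth_antimono[of 0 i q] ij by simp
  then have wq: "w ! (q - 1) = w ! q" "0 < q" using nrm[OF 2(1)] e0 by (auto simp: locally_normal_def)
  have lab: "ls ! i = q" "ls ! (j - 1) = q" using 2(2)[of i] 2(2)[of "j - 1"] ij by simp_all
  have i: "lo q \<le> i" "i < hi q" using label_eq_iff[of i q] lab ij by auto
  have "take q w = Y @ [E i ! q]"
    using 2(4) i take_E[of i q] 2(1) nonzeros_take_w[of q] by simp
  then have "E i ! q = w ! q" using last_take_w[OF 2(1)] wq by simp
  have il: "i = lo q"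
  proof (rule ccontr)
    assume "i \<noteq> lo q"
    then have "E i ! q \<le> E (Suc (lo q)) ! q" using i ij by (intro E_nth_antimono) auto
    also have "\<dots> = w ! q - 1"
      using E_nth_Suc[of "lo q" q] label_eq_iff[of "lo q" q] i ij by (simp add: E_lo)
    finally show False using \<open>E i ! q = w ! q\<close> w2 by simp
  qed
  have "j - 1 < hi q" using label_eq_iff[of "j - 1" q] lab ij by simp
  moreover have "\<not> j < hi q"
  proof
    assume "j < hi q"
    moreover then have "j < d" using hi_le[of q] by linarith
    ultimately have "ls ! j = q" using label_eq_iff[of j q] i ij by simp
    then show False using E_label_pos[OF \<open>j < d\<close>] 2(3) by simp
  qed
  ultimately have "j = hi q" by simp
  then show ?thesis using that(2) 2(1) w2 e0 il by blast
qed

text \<open>The left neighbour is the same letter \<open>z\<close>. If it is decreased instead, the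
  intact \<open>z\<close> at \<open>q\<close> takes its place in the word reached at
  \<open>hi q\<close>.\<close>

lemma block_min_skip:
  assumes q: "q < length w" "2 \<le> w ! q" "E d ! q = 0"
  shows "min_skip (lo q) (hi q)"
proof -
  have wq: "w ! (q - 1) = w ! q" "0 < q" using nrm[OF q(1)] q by (auto simp: locally_normal_def)
  have len: "hi q = lo q + w ! q" using hi_eq[of q] q lo_le_hi[of q] by simp
  then have lh: "lo q < hi q" "lo q < d" using q hi_le[of q] by auto
  define P z T where "P = take (q - 1) w" and "z = w ! q" and "T = drop (Suc q) (E (lo q))"
  have T: "drop (Suc q) (E (hi q)) = T"
    unfolding T_def
  proof (rule nth_equalityI)
    fix p assume p: "p < length (drop (Suc q) (E (hi q)))"
    have "E (hi q) ! (Suc q + p) = E (lo q) ! (Suc q + p)"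
    proof (rule E_nth_unchanged)
      fix n assume "lo q \<le> n" "n < hi q"
      then have "ls ! n = q" using label_eq_iff[of n q] hi_le[of q] by simp
      then show "ls ! n \<noteq> Suc q + p" by simp
    qed (simp_all add: lo_le_hi hi_le)
    then show "drop (Suc q) (E (hi q)) ! p = drop (Suc q) (E (lo q)) ! p" using p by simp
  qed simp
  have tk: "take q w = P @ [z]"
    using take_Suc_conv_app_nth[of "q - 1" w] wq q by (simp add: P_def z_def)
  have lenP: "length P = q - 1" using q by (simp add: P_def)
  have Ehi: "E (hi q) = (P @ [z]) @ 0 # T"
    using E_split[OF q(1), of "hi q"] take_E[of "hi q" q] tk q T by (simp add: E_hi)
  have Elo: "E (lo q) = P @ z # z # T"
    using E_split[OF q(1), of "lo q"] take_E[of "lo q" q] tk q lo_le_hi[of q]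
    by (simp add: E_lo T_def z_def)
  have P: "nonzeros P = P" using nonzeros_take_w[of "q - 1"] by (simp add: P_def)
  have z2: "2 \<le> z" using q by (simp add: z_def)
  have 1: "nonzeros (decr (E (lo q)) (q - 1)) = ((P @ [z - 1]) @ [z]) @ nonzeros T"
    unfolding Elo decr_split[OF lenP[symmetric]] using z2 P by (simp add: nonzeros_Cons)
  have 2: "nonzeros (E (hi q)) = (P @ [z]) @ nonzeros T"
    unfolding Ehi using z2 P by (simp add: nonzeros_Cons)
  have "emb P (P @ [z - 1])" by (rule list_emb_prefix) simp
  then have "emb (P @ [z]) ((P @ [z - 1]) @ [z])" using emb_snoc_iff by blast
  then have "emb (nonzeros (E (hi q))) (nonzeros (decr (E (lo q)) (q - 1)))"
    by (simp only: 1 2 emb_append_cancel)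
  moreover have "E (lo q) ! (q - 1) = z" unfolding Elo using lenP by (simp add: nth_append)
  moreover have "ls ! lo q = q" using label_eq_iff lh by simp
  ultimately have "jump (lo q) (q - 1) (hi q)"
    using lh wq z2 hi_le by (simp add: jump_def)
  then have "skips (lo q) (hi q)" by (auto simp: skips_def)
  then obtain i j where ij: "min_skip i j" "lo q \<le> i" "j \<le> hi q"
    using skips_imp_min_skip by blast
  \<comment> \<open>Constant labels exclude a descent, so a minimal interval inside is a block, and
    its labels identify its position as \<open>q\<close>.\<close>
  from ij(1) show ?thesis
  proof (cases rule: min_skip_normal_cases)
    case 1
    then have "Suc i < hi q" "Suc i < d" using ij hi_le[of q] by linarith+
    then show ?thesis
      using 1 ij label_eq_iff[of i q] label_eq_iff[of "Suc i" q] by simp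
  next
    case (2 q')
    have "lo q' < hi q'" using hi_eq[of q'] 2 by (metis add_0 diff_is_0_eq' not_less not_numeral_le_zero)
    then have "lo q' < d" using hi_le[of q'] by linarith
    then have "q' = q"
      using label_eq_iff[of "lo q'" q'] label_eq_iff[of "lo q'" q] ij 2 \<open>lo q' < hi q'\<close> by auto
    then show ?thesis using ij 2 by simp
  qed
qed

text \<open>Look at the labels before and after \<open>v_k\<close>. If they are equal, the entry
  drops by at least 2, and normality allows this only if it drops to 0, which gives a block.\<close>

lemma normal_imp_cover:
  assumes "0 < k" "k < d"
  shows "\<exists>i j. min_skip i j \<and> i < k \<and> k < j"
proof (cases "ls ! k < ls ! (k - 1)")
  case True
  then show ?thesis
    using descent_min_skip[of "k - 1"] assms by (intro exI[of _ "k - 1"] exI[of _ "k - 1 + 2"]) auto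
next
  case False
  define q where "q = ls ! k"
  have "ls ! (k - 1) = q" using False dec_nth[of "k - 1" k] assms by (simp add: q_def)
  then have k: "lo q \<le> k - 1" "k < hi q"
    using label_eq_iff[of "k - 1" q] label_eq_iff[of k q] assms by (auto simp: q_def)
  have q: "q < length w" using label_less assms by (simp add: q_def)
  have "2 \<le> hi q - lo q" using k assms by linarith
  then have "E d ! q + 2 \<le> w ! q" using hi_eq[of q] by linarith
  then have "E d ! q = 0" "2 \<le> w ! q" using nrm_cases[OF q] by fastforce+
  from block_min_skip[OF q this(2,1)] show ?thesis using k assms by fastforce
qed

text \<open>The labels before and after \<open>v_k\<close> identify the interval: different labels
  mean the descent at \<open>v_k\<close>, equal ones the block of that label.\<close>

lemma min_skip_disjoint:
  assumes "min_skip i j" "min_skip i' j'" "i < k" "k < j" "i' < k" "k < j'"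
  shows "i = i' \<and> j = j'"
proof -
  have kd: "k < d" using assms skips_less by (force simp: min_skip_def)
  have block: "ls ! (k - 1) = q \<and> ls ! k = q" if "lo q < k" "k < hi q" for q
    using that kd label_eq_iff[of "k - 1" q] label_eq_iff[of k q] by auto
  from assms(1) show ?thesis
  proof (cases rule: min_skip_normal_cases)
    case 1
    then have i: "k = Suc i" using assms by simp
    from assms(2) show ?thesis
    proof (cases rule: min_skip_normal_cases)
      case 1
      then show ?thesis using assms \<open>j = i + 2\<close> by simp
    next
      case (2 q)
      then show ?thesis using block[of q] assms i 1 by simp
    qed
  next
    case (2 q)
    from assms(2) show ?thesis
    proof (cases rule: min_skip_normal_cases)
      case 1
      then have k': "k = Suc i'" using assms by simp
      have "ls ! i' = q" "ls ! Suc i' = q" using block[of q] assms 2 unfolding k' by simp_all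
      then show ?thesis using 1 by simp
    next
      case (2 q')
      then show ?thesis using block[of q] block[of q'] assms \<open>i = lo q\<close> \<open>j = hi q\<close> by simp
    qed
  qed
qed

lemma MSIs_disjoint:
  assumes "S \<in> MSIs bot_word w C" "T \<in> MSIs bot_word w C" "S \<noteq> T"
  shows "S \<inter> T = {}"
proof (rule ccontr)
  assume "S \<inter> T \<noteq> {}"
  obtain i j i' j' where *: "min_skip i j" "S = open_interval C i j"
    "min_skip i' j'" "T = open_interval C i' j'"
    using assms by (auto simp: MSIs_conv)
  then have le: "j \<le> d" "j' \<le> d" using skips_less by (auto simp: min_skip_def)
  obtain k where k: "i < k" "k < j" "C ! k \<in> T"
    using \<open>S \<inter> T \<noteq> {}\<close> by (auto simp: * open_interval_def)
  then have "i' < k \<and> k < j'" using C_in_open_interval_iff[of k j' i'] le * by simp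
  then have "i = i' \<and> j = j'" using min_skip_disjoint * k by blast
  then show False using * assms(3) by simp
qed

lemma MSIs_nonempty: "S \<in> MSIs bot_word w C \<Longrightarrow> S \<noteq> {}"
proof -
  assume "S \<in> MSIs bot_word w C"
  then obtain i j where *: "min_skip i j" "S = open_interval C i j" by (auto simp: MSIs_conv)
  then have "i + 2 \<le> j" using skips_less by (auto simp: min_skip_def)
  then have "C ! Suc i \<in> S" using * by (auto simp: open_interval_def)
  then show ?thesis by auto
qed

lemma J_sets_eq_MSIs: "J_sets bot_word w C = MSIs bot_word w C"
proof -
  have "set (disjointify (MSI_list bot_word w C)) = set (MSI_list bot_word w C)"
    by (rule set_disjointify) (auto simp: set_MSI_list dest: MSIs_nonempty MSIs_disjoint)
  then show ?thesis by (simp add: J_sets_def set_MSI_list)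
qed

lemma critical: "critical bot_word w C"
proof -
  have "\<Union> (MSIs bot_word w C) = open_interval C 0 d"
  proof (intro equalityI subsetI)
    fix v assume "v \<in> \<Union> (MSIs bot_word w C)"
    then obtain i j where *: "min_skip i j" "v \<in> open_interval C i j" by (auto simp: MSIs_conv)
    then have "j \<le> d" using skips_less by (auto simp: min_skip_def)
    with * show "v \<in> open_interval C 0 d" by (fastforce simp: open_interval_def)
  next
    fix v assume "v \<in> open_interval C 0 d"
    then obtain k where k: "0 < k" "k < d" "v = C ! k" by (auto simp: open_interval_def)
    then obtain i j where "min_skip i j" "i < k" "k < j" using normal_imp_cover by blast
    then show "v \<in> \<Union> (MSIs bot_word w C)" using k by (auto simp: MSIs_conv open_interval_def)
  qed
  then show ?thesis by (simp add: critical_def J_sets_eq_MSIs)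
qed

lemma set_ls: "set ls = {q. q < length w \<and> E d ! q < w ! q}"
proof (intro equalityI subsetI)
  fix q assume "q \<in> set ls"
  then obtain k where k: "k < d" "ls ! k = q" by (auto simp: in_set_conv_nth)
  then have "lo q < hi q" using label_eq_iff[of k q] by simp
  then show "q \<in> {q. q < length w \<and> E d ! q < w ! q}"
    using hi_eq[of q] label_less[OF k(1)] k by auto
next
  fix q assume "q \<in> {q. q < length w \<and> E d ! q < w ! q}"
  then have "lo q < hi q" using hi_eq[of q] by (metis (lifting) add_0_right diff_is_0_eq' mem_Collect_eq not_less less_irrefl)
  moreover then have "lo q < d" using hi_le[of q] by linarith
  ultimately show "q \<in> set ls" using label_eq_iff[of "lo q" q] by (metis nth_mem order_refl)
qed

text \<open>The labels are the positions whose entry decreased. A deleted 1 belongs to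
  \<open>?A\<close>, since \<open>w ! q - 1\<close> is 0 there, and \<open>?B\<close> requires
  \<open>2 \<le> w ! q\<close>, so nothing is counted twice.\<close>

lemma card_set_ls: "card (set ls) = defect (E d) w + big_defect (E d) w"
proof -
  let ?A = "{q. q < length w \<and> E d ! q = w ! q - 1}"
  let ?B = "{q. q < length w \<and> E d ! q = 0 \<and> 2 \<le> w ! q}"
  have "E d ! q < w ! q \<longleftrightarrow> E d ! q = w ! q - 1 \<or> E d ! q = 0 \<and> 2 \<le> w ! q" if "q < length w" for q
    by (rule nrm_cases[OF that]) (use w_pos[OF that] in auto)
  then have "set ls = ?A \<union> ?B" unfolding set_ls by auto
  moreover have "?A \<inter> ?B = {}" by auto
  ultimately show ?thesis unfolding defect_def big_defect_def by (simp add: card_Un_disjoint)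
qed

text \<open>Assign to each descent the label after it. Every label except the first and largest is
  entered by exactly one descent.\<close>

lemma card_descents:
  assumes "0 < d"
  shows "Suc (card {i. Suc i < d \<and> ls ! Suc i < ls ! i}) = card (set ls)"
proof -
  let ?D = "{i. Suc i < d \<and> ls ! Suc i < ls ! i}"
  have inj: "inj_on (\<lambda>i. ls ! Suc i) ?D"
  proof (rule linorder_inj_onI)
    fix i i' assume "i < i'" "i \<in> ?D" "i' \<in> ?D"
    then have "ls ! Suc i' < ls ! i'" "ls ! i' \<le> ls ! Suc i" by (auto intro: dec_nth)
    then show "ls ! Suc i \<noteq> ls ! Suc i'" by simp
  qed auto
  have im: "(\<lambda>i. ls ! Suc i) ` ?D = set ls - {ls ! 0}"
  proof (intro equalityI subsetI)
    fix q assume "q \<in> (\<lambda>i. ls ! Suc i) ` ?D"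
    then obtain i where i: "Suc i < d" "ls ! Suc i < ls ! i" "q = ls ! Suc i" by auto
    moreover have "ls ! i \<le> ls ! 0" using i by (intro dec_nth) auto
    ultimately show "q \<in> set ls - {ls ! 0}" by auto
  next
    fix q assume "q \<in> set ls - {ls ! 0}"
    then obtain k where k: "k < d" "ls ! k = q" "q \<noteq> ls ! 0" by (auto simp: in_set_conv_nth)
    then have lk: "lo q \<le> k" "k < hi q" using label_eq_iff by auto
    then have "ls ! lo q = q" using label_eq_iff[of "lo q" q] k by simp
    moreover from this have "0 < lo q" using k by (cases "lo q") auto
    moreover from this have "q < ls ! (lo q - 1)" using less_lo_iff[of "lo q - 1" q] lk k by simp
    ultimately show "q \<in> (\<lambda>i. ls ! Suc i) ` ?D"
      using lk k by (intro image_eqI[of _ _ "lo q - 1"]) auto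
  qed
  have "card ?D = card (set ls - {ls ! 0})" unfolding im[symmetric] by (rule card_image[OF inj, symmetric])
  moreover have "ls ! 0 \<in> set ls" using assms by simp
  ultimately show ?thesis by (metis List.finite_set card_Suc_Diff1)
qed

text \<open>Index pairs are counted first; descents and blocks do not overlap, because a block
  begins with two equal labels. For \<open>d = 0\<close> there is no first label to subtract: all
  counts vanish and the formula would fail.\<close>

lemma card_MSIs:
  assumes "0 < d"
  shows "Suc (card (MSIs bot_word w C)) = defect (E d) w + 2 * big_defect (E d) w"
proof -
  let ?D = "{i. Suc i < d \<and> ls ! Suc i < ls ! i}"
  let ?B = "{q. q < length w \<and> E d ! q = 0 \<and> 2 \<le> w ! q}"
  let ?P = "{(i, j). min_skip i j}"
  have block: "Suc (lo q) < hi q" if "q \<in> ?B" for q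
    using hi_eq[of q] that by auto
  have block_labels: "ls ! lo q = q \<and> ls ! Suc (lo q) = q" if "q \<in> ?B" for q
    using block[OF that] label_eq_iff[of "lo q" q] label_eq_iff[of "Suc (lo q)" q] hi_le[of q] by simp
  have P: "?P = (\<lambda>i. (i, i + 2)) ` ?D \<union> (\<lambda>q. (lo q, hi q)) ` ?B"
  proof (intro equalityI subsetI)
    fix x assume "x \<in> ?P"
    then obtain i j where x: "x = (i, j)" "min_skip i j" by auto
    then have "j \<le> d" using skips_less by (auto simp: min_skip_def)
    from x(2) show "x \<in> (\<lambda>i. (i, i + 2)) ` ?D \<union> (\<lambda>q. (lo q, hi q)) ` ?B"
      by (cases rule: min_skip_normal_cases) (use x \<open>j \<le> d\<close> in auto)
  next
    fix x assume "x \<in> (\<lambda>i. (i, i + 2)) ` ?D \<union> (\<lambda>q. (lo q, hi q)) ` ?B"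
    then show "x \<in> ?P" using descent_min_skip block_min_skip by auto
  qed
  have "inj_on (\<lambda>q. (lo q, hi q)) ?B" using block_labels by (auto intro!: inj_onI) metis
  then have cB: "card ((\<lambda>q. (lo q, hi q)) ` ?B) = big_defect (E d) w"
    by (simp add: card_image big_defect_def)
  have cD: "card ((\<lambda>i. (i, i + 2)) ` ?D) = card ?D"
    by (rule card_image) (auto intro: inj_onI)
  have "(\<lambda>i. (i, i + 2)) ` ?D \<inter> (\<lambda>q. (lo q, hi q)) ` ?B = {}"
    using block_labels by fastforce
  moreover have "finite ?D" by (rule finite_subset[of _ "{..<d}"]) auto
  ultimately have "card ?P = card ((\<lambda>i. (i, i + 2)) ` ?D) + card ((\<lambda>q. (lo q, hi q)) ` ?B)"
    unfolding P by (intro card_Un_disjoint) simp_all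
  then have "card ?P = card ?D + big_defect (E d) w" by (simp only: cB cD)
  moreover have "MSIs bot_word w C = (\<lambda>(i, j). open_interval C i j) ` ?P"
    by (auto simp: MSIs_conv)
  moreover have "inj_on (\<lambda>(i, j). open_interval C i j) ?P"
  proof (rule inj_onI, clarify)
    fix i j i' j' assume *: "min_skip i j" "min_skip i' j'" "open_interval C i j = open_interval C i' j'"
    then have "i + 2 \<le> j" "j \<le> d" "i' + 2 \<le> j'" "j' \<le> d"
      using skips_less by (auto simp: min_skip_def)
    then show "i = i' \<and> j = j'"
      using *(3) open_interval_subset_iff[of i j j' i'] open_interval_subset_iff[of i' j' j i] by auto
  qed
  ultimately show ?thesis
    using card_descents[OF assms] card_set_ls by (simp add: card_image)
qed

end

section \<open>Decreasing label sequences with a given end\<close>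

text \<open>Only a step from 1 to 0 is restricted, and such a step occurs just when all of
  \<open>x\<close> is removed.\<close>

lemma admissible_seq_replicate:
  assumes "c \<le> x" "c = x \<Longrightarrow> nonzeros A = [] \<or> last (nonzeros A) \<noteq> 1"
  shows "admissible_seq (A @ x # B) (replicate c (length A)) \<and>
    foldl decr (A @ x # B) (replicate c (length A)) = A @ (x - c) # B"
  using assms
proof (induction c arbitrary: x)
  case (Suc c)
  then have "admissible (A @ x # B) (length A)" by (auto simp: admissible_def)
  then show ?case using Suc by (simp add: decr_split)
qed simp

text \<open>Induction from the right end: the positions from \<open>n\<close> on already agree with
  \<open>e\<close>, and those before \<open>n\<close> are untouched, so all steps at position
  \<open>n\<close> can be appended at once.\<close>

lemma decreasing_seq_exists:
  assumes pos: "w \<in> pos_words" and len: "length e = length w"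
    and nrm: "\<And>q. q < length w \<Longrightarrow> locally_normal e w q" and "n \<le> length w"
  shows "\<exists>ls. admissible_seq w ls \<and> foldl decr w ls = take n w @ drop n e \<and>
    sorted_wrt (\<ge>) ls \<and> (\<forall>l\<in>set ls. n \<le> l)"
  using \<open>n \<le> length w\<close>
proof (induction n rule: inc_induct)
  case base
  show ?case by (intro exI[of _ "[]"]) (simp add: len)
next
  case (step n)
  then obtain ls where ls: "admissible_seq w ls"
    "foldl decr w ls = take (Suc n) w @ drop (Suc n) e" "sorted_wrt (\<ge>) ls" "\<forall>l\<in>set ls. Suc n \<le> l"
    by blast
  define c where "c = w ! n - e ! n"
  have n: "n < length w" using step by simp
  have wn: "0 < w ! n" using pos n by (auto simp: pos_words_def in_lists_conv_set)
  have en: "e ! n \<le> w ! n" using nrm[OF n] by (auto simp: locally_normal_def)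
  have eq: "foldl decr w ls = take n w @ w ! n # drop (Suc n) e"
    using n by (simp add: ls take_Suc_conv_app_nth)
  have "nonzeros (take n w) = take n w"
    using pos by (intro nonzeros_pos_words) (auto simp: pos_words_def dest: in_set_takeD)
  moreover have "take n w = [] \<or> last (take n w) \<noteq> 1" if "c = w ! n"
  proof -
    have "e ! n = 0" using that wn en by (simp add: c_def)
    \<comment> \<open>If \<open>w ! n\<close> is at least 2, normality makes its left neighbour the
      same letter, hence not a 1.\<close>
    then have "n = 0 \<or> w ! (n - 1) \<noteq> 1"
      using nrm[OF n] wn by (cases "w ! n = 1") (auto simp: locally_normal_def)
    moreover have "last (take n w) = w ! (n - 1)" if "0 < n"
      using that n by (subst last_conv_nth) auto
    ultimately show ?thesis by auto
  qed
  ultimately have r: "admissible_seq (foldl decr w ls) (replicate c n)"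
    "foldl decr (foldl decr w ls) (replicate c n) = take n w @ (w ! n - c) # drop (Suc n) e"
    using admissible_seq_replicate[of c "w ! n" "take n w" "drop (Suc n) e"] n
    unfolding eq by (auto simp: c_def)
  have rep: "sorted_wrt (\<ge>) (replicate c n)" by (induction c) auto
  have "take n w @ (w ! n - c) # drop (Suc n) e = take n w @ drop n e"
    using en n len by (simp add: c_def Cons_nth_drop_Suc)
  then show ?case
    using ls r rep
    by (intro exI[of _ "ls @ replicate c n"]) (auto simp: admissible_seq_append sorted_wrt_append)
qed

lemma foldl_decr_count:
  "admissible_seq e ls \<Longrightarrow> count_list ls p + foldl decr e ls ! p = e ! p"
proof (induction ls arbitrary: e)
  case (Cons i ls)
  then have i: "i < length e" "0 < e ! i" by (auto simp: admissible_def)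
  have "count_list ls p + foldl decr (decr e i) ls ! p = decr e i ! p" using Cons by simp
  then show ?case using i by (auto simp: nth_decr)
qed simp

text \<open>The number of occurrences of each label is the total drop of its entry, and a sorted
  list is determined by its multiset.\<close>

lemma decreasing_seq_unique:
  assumes "admissible_seq w ls" "admissible_seq w ls'" "foldl decr w ls = foldl decr w ls'"
    "sorted_wrt (\<ge>) ls" "sorted_wrt (\<ge>) ls'"
  shows "ls = ls'"
proof -
  have "count_list ls p = count_list ls' p" for p
    using foldl_decr_count[OF assms(1), of p] foldl_decr_count[OF assms(2), of p] assms(3) by simp
  then have "mset (rev ls) = mset (rev ls')" by (simp add: multiset_eq_iff count_mset)
  moreover have "sorted (rev ls)" "sorted (rev ls')" using assms by (simp_all add: sorted_wrt_rev)
  ultimately have "rev ls = rev ls'" by (metis properties_for_sort)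
  then show ?thesis by simp
qed

lemma weakly_decreasing_chain_of:
  "w \<in> pos_words \<Longrightarrow> admissible_seq w ls \<Longrightarrow> weakly_decreasing (chain_of w ls) \<longleftrightarrow> sorted_wrt (\<ge>) ls"
  by (simp add: weakly_decreasing_def chain_labels_chain_of)

section \<open>From criticality to decreasing labels\<close>

lemma (in labelled_chain) critical_imp_cover:
  assumes "critical bot_word w C" "0 < k" "k < d"
  shows "\<exists>i j. min_skip i j \<and> i < k \<and> k < j"
proof -
  have "C ! k \<in> open_interval C 0 (length C - 1)" using assms by (auto simp: open_interval_def)
  then have "C ! k \<in> \<Union> (J_sets bot_word w C)" using assms(1) by (simp add: critical_def)
  also have "\<dots> \<subseteq> \<Union> (MSIs bot_word w C)"
    using Union_disjointify by (simp add: J_sets_def flip: set_MSI_list)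
  finally obtain i j where ij: "min_skip i j" "C ! k \<in> open_interval C i j"
    by (auto simp: MSIs_conv)
  moreover have "j \<le> d" using ij(1) skips_less by (auto simp: min_skip_def)
  ultimately show ?thesis using C_in_open_interval_iff[of k j i] assms by auto
qed

text \<open>Two consecutive labels surround an inner element of the chain, and the interval covering
  it is either a descent or a block of constant label.\<close>

lemma (in labelled_chain) cover_imp_decreasing:
  assumes cover: "\<And>k. 0 < k \<Longrightarrow> k < d \<Longrightarrow> \<exists>i j. min_skip i j \<and> i < k \<and> k < j"
  shows "sorted_wrt (\<ge>) ls"
proof -
  have "ls ! Suc k \<le> ls ! k" if k: "Suc k < d" for k
  proof -
    obtain i j where ij: "min_skip i j" "i < Suc k" "Suc k < j"
      using cover[OF zero_less_Suc k] by blast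
    from ij(1) show ?thesis
    proof (cases rule: min_skip_cases)
      case 1
      then have "k = i" using ij by simp
      then show ?thesis using 1 by simp
    next
      case (2 q Y)
      then show ?thesis using ij by simp
    qed
  qed
  moreover have "transp ((\<ge>) :: nat \<Rightarrow> nat \<Rightarrow> bool)" by (rule transpI) simp
  ultimately show ?thesis using sorted_wrt_iff_nth_Suc_transp by blast
qed

section \<open>Critical chains and normal embeddings\<close>

theorem theorem4p4:
  fixes u w :: "nat list"
  assumes "u \<in> pos_words" and "w \<in> pos_words" and "u \<preceq> w"
  shows "(\<forall>e. is_normal e u w \<longrightarrow>
            (\<exists>!C. max_chain u w C \<and> weakly_decreasing C \<and> chain_end C = e)) \<and>
         bij_betw (\<lambda>e. THE C. max_chain u w C \<and> weakly_decreasing C \<and> chain_end C = e)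
           {e. is_normal e u w}
           {C. max_chain u w C \<and> critical u w C} \<and>
         (\<forall>C. max_chain u w C \<and> critical u w C \<longrightarrow>
            MSIs u w C = J_sets u w C \<and>
            (u \<noteq> w \<longrightarrow>
               int (card (MSIs u w C)) =
                 int (defect (chain_end C) w) + 2 * int (big_defect (chain_end C) w) - 1))"
proof -
  note pos = assms(2)
  let ?P = "\<lambda>C e. max_chain u w C \<and> weakly_decreasing C \<and> chain_end C = e"
  have unique: "\<exists>!C. ?P C e" if e: "is_normal e u w" for e
  proof (rule ex_ex1I)
    have len: "length e = length w" and u: "u = nonzeros e"
      and loc: "\<And>q. q < length w \<Longrightarrow> locally_normal e w q"
      using e by (auto simp: is_normal_iff is_embedding_def is_expansion_def)
    obtain ls where ls: "admissible_seq w ls" "foldl decr w ls = e" "sorted_wrt (\<ge>) ls"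
      using decreasing_seq_exists[OF pos len loc, of 0] by auto
    then have "?P (chain_of w ls) e"
      using u by (auto simp: max_chain_conv[OF pos] weakly_decreasing_chain_of[OF pos] 
          chain_end_chain_of[OF pos])
    then show "\<exists>C. ?P C e" ..
  next
    fix C C' assume C: "?P C e" and C': "?P C' e"
    obtain ls where ls: "admissible_seq w ls" "C = chain_of w ls"
      using C max_chain_conv[OF pos] by blast
    obtain ls' where ls': "admissible_seq w ls'" "C' = chain_of w ls'"
      using C' max_chain_conv[OF pos] by blast
    have "ls = ls'"
      by (rule decreasing_seq_unique[of w])
        (use C C' ls ls' in \<open>simp_all add: weakly_decreasing_chain_of[OF pos] chain_end_chain_of[OF pos]\<close>)
    then show "C = C'" using ls ls' by simp
  qed
  have normal: "critical u w C \<and> MSIs u w C = J_sets u w C \<and> (u \<noteq> w \<longrightarrow> int (card (MSIs u w C)) =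
      int (defect (chain_end C) w) + 2 * int (big_defect (chain_end C) w) - 1)"
    if C: "?P C e" and e: "is_normal e u w" for C e
  proof -
    obtain ls where ls: "admissible_seq w ls" "C = chain_of w ls" "u = nonzeros (foldl decr w ls)"
      using C max_chain_conv[OF pos] by blast
    interpret labelled_chain w ls by unfold_locales (fact pos ls(1))+
    have Ed: "E d = foldl decr w ls" by (simp add: E_def)
    then have end_eq: "chain_end C = E d" using ls by (simp add: chain_end_chain_of[OF pos])
    interpret normal_chain w ls
    proof unfold_locales
      show "sorted_wrt (\<ge>) ls" using C ls by (simp add: weakly_decreasing_chain_of[OF pos])
      fix q assume "q < length w"
      then show "locally_normal (E d) w q" using C e end_eq by (auto simp: is_normal_iff)
    qed
    have u: "u = bot_word" using ls Ed by simp
    have "int (card (MSIs u w C)) = int (defect (E d) w) + 2 * int (big_defect (E d) w) - 1"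
      if "u \<noteq> w"
    proof -
      have "0 < d" using that ls(3) nonzeros_pos_words[OF pos] by auto
      then have "Suc (card (MSIs u w C)) = defect (E d) w + 2 * big_defect (E d) w"
        unfolding u ls(2) by (rule card_MSIs)
      then show ?thesis by linarith
    qed
    moreover have "critical u w C" "MSIs u w C = J_sets u w C"
      unfolding u ls(2) by (fact critical, fact J_sets_eq_MSIs[symmetric])
    ultimately show ?thesis unfolding end_eq by blast
  qed
  \<comment> \<open>Two stages: covering first yields decreasing labels, which opens the locale in
    which the end is shown to be normal.\<close>
  have critical: "?P C (chain_end C) \<and> is_normal (chain_end C) u w"
    if C: "max_chain u w C" "critical u w C" for C
  proof -
    obtain ls where ls: "admissible_seq w ls" "C = chain_of w ls" "u = nonzeros (foldl decr w ls)"
      using C max_chain_conv[OF pos] by blast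
    interpret labelled_chain w ls by unfold_locales (fact pos ls(1))+
    have u: "u = bot_word" using ls by (simp add: E_def)
    have end_eq: "chain_end C = E d" using ls by (simp add: chain_end_chain_of[OF pos] E_def)
    note cover = critical_imp_cover[OF C(2)[unfolded u ls(2)]]
    have dec: "sorted_wrt (\<ge>) ls" using cover by (rule cover_imp_decreasing)
    interpret decreasing_chain w ls by unfold_locales (fact dec)
    have "is_normal (chain_end C) u w"
      unfolding end_eq u using cover by (rule cover_imp_normal)
    moreover have "weakly_decreasing C"
      unfolding ls(2) using dec ls(1) by (simp add: weakly_decreasing_chain_of[OF pos])
    ultimately show ?thesis using C(1) by blast
  qed
  let ?F = "\<lambda>e. THE C. ?P C e"
  have F: "?P (?F e) e" if "is_normal e u w" for e
    using theI'[OF unique[OF that]] .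
  have "bij_betw ?F {e. is_normal e u w} {C. max_chain u w C \<and> critical u w C}"
  proof (rule bij_betw_byWitness[where f' = chain_end])
    show "?F ` {e. is_normal e u w} \<subseteq> {C. max_chain u w C \<and> critical u w C}"
      using F normal by blast
    show "chain_end ` {C. max_chain u w C \<and> critical u w C} \<subseteq> {e. is_normal e u w}"
      using critical by blast
    show "\<forall>e\<in>{e. is_normal e u w}. chain_end (?F e) = e"
      using F by blast
    show "\<forall>C\<in>{C. max_chain u w C \<and> critical u w C}. ?F (chain_end C) = C"
      using the1_equality[OF unique] critical by blast
  qed
  moreover have "MSIs u w C = J_sets u w C \<and> (u \<noteq> w \<longrightarrow> int (card (MSIs u w C)) =
      int (defect (chain_end C) w) + 2 * int (big_defect (chain_end C) w) - 1)"
    if "max_chain u w C \<and> critical u w C" for C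
    using normal critical that by blast
  ultimately show ?thesis using unique by blast
qed

end
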